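(* Let $G=(V,E)$ be a graph on $n$ vertices, and let $m\ge 1$, $d\ge1$ be integers. (1) If $G$ has at least $m$ vertex-disjoint $d$-bounded edges, then a random game sampled from $\mathcal{D}_G$ has no pure Nash equilibrium with probability at least $$1-\exp\Big(-m\big(\tfrac18\big)^{2^{2d-2}}\Big).$$ (2) In particular, if $G$ has at least $m$ edges that are $d$-bounded, then a game sampled from $\mathcal{D}_G$ has no pure Nash equilibrium with probability at least $$1-\exp\Big(-\frac{m}{2d}\big(\tfrac18\big)^{2^{2d-2}}\Big).$$ (3) Moreover, there exists an algorithm of complexity $O(n^2+m2^{d+2})$ for proving that a pure Nash equilibrium does not exist (whenever it succeeds, the input game has no pure Nash equilibrium), whose success probability on a game sampled from $\mathcal{D}_G$ is at least the bound in (1) under the hypothesis of (1), and at least the bound in (2) under the hypothesis of (2). (4) More generally, for an arbitrary graph $G=(V,E)$, assign to every edge $(u,v)\in E$ the weight $w_{(u,v)}:=-\log_e(1-p_{(u,v)})$, where $p_{(u,v)}=8^{-2^{d_u+d_v-2}}$ and $d_u,d_v$ are the degrees of $u$ and $v$ in $G$. If $\mathcal{E}$ is a maximal weighted independent edge-set for these weights, with value $w_{\mathcal{E}}$, then the probability that a game sampled from $\mathcal{D}_G$ has no pure Nash equilibrium is at least $1-\exp(-w_{\mathcal{E}})$.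
   Context: Graphs are finite, simple and undirected. For a graph $G=(V,E)$ and $v\in V$, $\mathcal{N}(v)=\{v'\in V: (v,v')\in E\}$. An edge $(u,v)\in E$ is $d$-bounded if both $u$ and $v$ have degree at most $d$. A subset $\mathcal{E}\subseteq E$ is independent if no two edges in $\mathcal{E}$ are adjacent (share a vertex). Given edge weights $w:E\to\mathbb{R}$, put $w_{\mathcal{E}}=\sum_{e\in\mathcal{E}}w(e)$; a maximal weighted independent edge-set is an independent edge-set of maximum weight among all independent edge-sets. Random best-response model $\mathcal{D}_G$: the players are the vertices of $G$, each player $v$ has strategy set $S_v=\{0,1\}$. A (binary) game on $G$ is specified by best-response tables $\mathrm{BR}_v:\{0,1\}\times\{0,1\}^{\mathcal{N}(v)}\to\{0,1\}$, $v\in V$. Under $\mathcal{D}_G$, the values $\mathrm{BR}_v(0,\sigma_{\mathcal{N}(v)})$, over all $v\in V$ and all $\sigma_{\mathcal{N}(v)}\in\{0,1\}^{\mathcal{N}(v)}$, are mutually independent and uniform in $\{0,1\}$, and $\mathrm{BR}_v(1,\sigma_{\mathcal{N}(v)})=1-\mathrm{BR}_v(0,\sigma_{\mathcal{N}(v)})$. (This is the law, up to probability-zero events, of the best-response tables of a graphical game on $G$ all of whose payoff entries are i.i.d. from an atomless distribution on $\mathbb{R}$, where $\mathrm{BR}_v(\sigma_v,\sigma_{\mathcal{N}(v)})=1$ iff $\sigma_v$ maximizes the payoff of $v$ given $\sigma_{\mathcal{N}(v)}$.) A pure Nash equilibrium (PNE) is a profile $\sigma\in\{0,1\}^V$ with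 $\mathrm{BR}_v(\sigma_v,\sigma_{\mathcal{N}(v)})=1$ for all $v\in V$. The algorithm receives as input the graph and the tables of the players of the game. *)

theory Defs
  imports "HOL-Probability.Probability" "HOL-Probability.Product_PMF"
begin

section \<open>Graphs\<close>

text \<open>Finite simple undirected graphs; an edge is the two-element set of its endpoints, so that
  counting edges counts unordered pairs.\<close>

definition simple_graph :: "'a set \<Rightarrow> 'a set set \<Rightarrow> bool" where
  "simple_graph V E \<longleftrightarrow> finite V \<and> (\<forall>e\<in>E. e \<subseteq> V \<and> card e = 2)"

definition nbhd :: "'a set set \<Rightarrow> 'a \<Rightarrow> 'a set" where
  "nbhd E v = {u. {u, v} \<in> E}"

definition degree :: "'a set set \<Rightarrow> 'a \<Rightarrow> nat" where
  "degree E v = card (nbhd E v)"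

definition bounded_edges :: "'a set set \<Rightarrow> nat \<Rightarrow> 'a set set" where
  "bounded_edges E d = {e \<in> E. \<forall>v\<in>e. degree E v \<le> d}"

definition independent_edges :: "'a set set \<Rightarrow> 'a set set \<Rightarrow> bool" where
  "independent_edges E S \<longleftrightarrow> S \<subseteq> E \<and> pairwise disjnt S"

definition max_weight_independent :: "'a set set \<Rightarrow> ('a set \<Rightarrow> real) \<Rightarrow> 'a set set \<Rightarrow> bool" where
  "max_weight_independent E w S \<longleftrightarrow>
     independent_edges E S \<and> (\<forall>T. independent_edges E T \<longrightarrow> sum w T \<le> sum w S)"

text \<open>For an edge \<open>e = {u, v}\<close> the sum over \<open>e\<close> is \<open>d\<^sub>u + d\<^sub>v\<close>, which is at least 2.\<close>

definition edge_prob :: "'a set set \<Rightarrow> 'a set \<Rightarrow> real" where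
  "edge_prob E e = 1 / 8 ^ (2 ^ ((\<Sum>v\<in>e. degree E v) - 2))"

definition edge_weight :: "'a set set \<Rightarrow> 'a set \<Rightarrow> real" where
  "edge_weight E e = - ln (1 - edge_prob E e)"


section \<open>Binary games and the random best-response model\<close>

text \<open>Strategies 0 and 1 are \<open>False\<close> and \<open>True\<close>. A game maps a player, an own strategy and a
  profile of the neighbours to the entry of the best-response table. A profile of a set
  \<open>A\<close> of players is an extensional function, that is, an element of
  \<open>A \<rightarrow>\<^sub>E UNIV\<close>; the values of a game at other arguments are junk and are never used.\<close>

type_synonym 'a game = "'a \<Rightarrow> bool \<Rightarrow> ('a \<Rightarrow> bool) \<Rightarrow> bool"

definition is_PNE :: "'a set \<Rightarrow> 'a set set \<Rightarrow> 'a game \<Rightarrow> ('a \<Rightarrow> bool) \<Rightarrow> bool" where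
  "is_PNE V E BR \<sigma> \<longleftrightarrow>
     \<sigma> \<in> V \<rightarrow>\<^sub>E UNIV \<and> (\<forall>v\<in>V. BR v (\<sigma> v) (restrict \<sigma> (nbhd E v)))"

definition has_PNE :: "'a set \<Rightarrow> 'a set set \<Rightarrow> 'a game \<Rightarrow> bool" where
  "has_PNE V E BR \<longleftrightarrow> (\<exists>\<sigma>. is_PNE V E BR \<sigma>)"

text \<open>The function \<open>f\<close> drawn below collects the independent fair bits
  \<open>BR\<^sub>v(0, \<tau>)\<close> for all players \<open>v\<close> and all profiles \<open>\<tau>\<close> of the neighbours of \<open>v\<close>.\<close>

definition random_game :: "'a set \<Rightarrow> 'a set set \<Rightarrow> 'a game pmf" where
  "random_game V E =
     map_pmf (\<lambda>f v s \<tau>. if s then \<not> f (v, \<tau>) else f (v, \<tau>))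
       (Pi_pmf (SIGMA v:V. nbhd E v \<rightarrow>\<^sub>E UNIV) False (\<lambda>_. pmf_of_set UNIV))"


section \<open>Algorithms: a random access machine\<close>

text \<open>A random access machine with natural-number registers and an indirectly addressed memory,
  programmed in a structured language. Each executed assignment and each evaluated test costs one
  step. The only arithmetic is addition and truncated subtraction.
  The input graph has vertices \<open>0, \<dots>, n - 1\<close>; its adjacency matrix and the best-response tables
  are read-only arrays with random access, so that a program need not read all of the
  (exponentially large) tables.\<close>

record input =
  adj_bit :: "nat \<Rightarrow> nat \<Rightarrow> bool"
  table_bit :: "nat \<Rightarrow> nat \<Rightarrow> bool"

datatype com =
    Const nat nat             \<comment> \<open>\<open>r\<^sub>x := k\<close>\<close>
  | Add nat nat nat           \<comment> \<open>\<open>r\<^sub>x := r\<^sub>y + r\<^sub>z\<close>\<close>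
  | Sub nat nat nat           \<comment> \<open>\<open>r\<^sub>x := r\<^sub>y - r\<^sub>z\<close>\<close>
  | Load nat nat              \<comment> \<open>\<open>r\<^sub>x := mem[r\<^sub>y]\<close>\<close>
  | Store nat nat             \<comment> \<open>\<open>mem[r\<^sub>x] := r\<^sub>y\<close>\<close>
  | Read_Adj nat nat nat      \<comment> \<open>\<open>r\<^sub>x :=\<close> entry \<open>(r\<^sub>y, r\<^sub>z)\<close> of the adjacency matrix\<close>
  | Read_Table nat nat nat    \<comment> \<open>\<open>r\<^sub>x :=\<close> entry \<open>r\<^sub>z\<close> of the table of player \<open>r\<^sub>y\<close>\<close>
  | Seq com com
  | If_Less nat nat com com   \<comment> \<open>test \<open>r\<^sub>x < r\<^sub>y\<close>\<close>
  | While_Less nat nat com    \<comment> \<open>while \<open>r\<^sub>x < r\<^sub>y\<close>\<close>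

type_synonym state = "(nat \<Rightarrow> nat) \<times> (nat \<Rightarrow> nat)"

text \<open>\<open>exec I c s t s'\<close>: on input \<open>I\<close>, command \<open>c\<close> started in state \<open>s\<close> (registers, memory)
  halts in state \<open>s'\<close> after \<open>t\<close> steps.\<close>

inductive exec :: "input \<Rightarrow> com \<Rightarrow> state \<Rightarrow> nat \<Rightarrow> state \<Rightarrow> bool" for I :: input where
  Const: "exec I (Const x k) (r, mem) 1 (r(x := k), mem)"
| Add: "exec I (Add x y z) (r, mem) 1 (r(x := r y + r z), mem)"
| Sub: "exec I (Sub x y z) (r, mem) 1 (r(x := r y - r z), mem)"
| Load: "exec I (Load x y) (r, mem) 1 (r(x := mem (r y)), mem)"
| Store: "exec I (Store x y) (r, mem) 1 (r, mem(r x := r y))"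
| Read_Adj: "exec I (Read_Adj x y z) (r, mem) 1 (r(x := of_bool (adj_bit I (r y) (r z))), mem)"
| Read_Table:
    "exec I (Read_Table x y z) (r, mem) 1 (r(x := of_bool (table_bit I (r y) (r z))), mem)"
| Seq: "exec I c1 s t1 s' \<Longrightarrow> exec I c2 s' t2 s'' \<Longrightarrow> exec I (Seq c1 c2) s (t1 + t2) s''"
| If_True: "fst s x < fst s y \<Longrightarrow> exec I c1 s t s' \<Longrightarrow> exec I (If_Less x y c1 c2) s (t + 1) s'"
| If_False: "\<not> fst s x < fst s y \<Longrightarrow> exec I c2 s t s' \<Longrightarrow> exec I (If_Less x y c1 c2) s (t + 1) s'"
| While_False: "\<not> fst s x < fst s y \<Longrightarrow> exec I (While_Less x y c) s 1 s"
| While_True: "fst s x < fst s y \<Longrightarrow> exec I c s t1 s' \<Longrightarrow> exec I (While_Less x y c) s' t2 s'' \<Longrightarrow>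
    exec I (While_Less x y c) s (t1 + t2 + 1) s''"

text \<open>A program has at most one halting run from a given state.\<close>

inductive_cases exec_SeqE: "exec I (Seq c1 c2) s t s'"
inductive_cases exec_IfE: "exec I (If_Less x y c1 c2) s t s'"
inductive_cases exec_WhileE: "exec I (While_Less x y c) s t s'"

lemma exec_deterministic:
  "exec I c s t s' \<Longrightarrow> exec I c s u s'' \<Longrightarrow> t = u \<and> s' = s''"
proof (induction arbitrary: u s'' rule: exec.induct)
  case (Seq c1 s t1 s' c2 t2 s3)
  from Seq.prems show ?case
    by (rule exec_SeqE) (metis Seq.IH)
next
  case (If_True s x y c1 t s' c2)
  from If_True.prems obtain u' where "u = u' + 1" "exec I c1 s u' s''"
    by (rule exec_IfE) (use If_True.hyps(1) in simp_all)
  then show ?case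
    using If_True.IH by auto
next
  case (If_False s x y c2 t s' c1)
  from If_False.prems obtain u' where "u = u' + 1" "exec I c2 s u' s''"
    by (rule exec_IfE) (use If_False.hyps(1) in simp_all)
  then show ?case
    using If_False.IH by auto
next
  case (While_False s x y c)
  from While_False.prems show ?case
    by (rule exec_WhileE) (use While_False.hyps in simp_all)
next
  case (While_True s x y c t1 s' t2 s3)
  from While_True.prems obtain u1 v u2 where u: "u = u1 + u2 + 1"
    "exec I c s u1 v" "exec I (While_Less x y c) v u2 s''"
    by (rule exec_WhileE) (use While_True.hyps(1) in simp_all)
  from u(2) have "t1 = u1 \<and> s' = v"
    by (rule While_True.IH(1))
  with u show ?case
    using While_True.IH(2) by auto
qed (erule exec.cases; simp)+

text \<open>Entry \<open>k\<close> of the table of player \<open>v\<close>, for \<open>k < 2 ^ (degree E v + 1)\<close>: bit 0 of \<open>k\<close> is the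
  strategy of \<open>v\<close>, and bit \<open>i + 1\<close> that of its neighbour number \<open>i\<close>, the neighbours being
  numbered \<open>0, 1, \<dots>\<close> in increasing order. Reads out of range return 0.\<close>

definition encode :: "nat \<Rightarrow> nat set set \<Rightarrow> nat game \<Rightarrow> input" where
  "encode n E BR =
     \<lparr> adj_bit = (\<lambda>u v. {u, v} \<in> E),
       table_bit = (\<lambda>v k. v < n \<and> k < 2 ^ (degree E v + 1) \<and>
         BR v (bit k 0) (\<lambda>u\<in>nbhd E v. bit k (card {w \<in> nbhd E v. w < u} + 1))) \<rparr>"

text \<open>Registers 0, 1, 2 initially hold the number of vertices and the parameters \<open>m\<close> and \<open>d\<close>;
  all other registers and the memory are 0. A halting program succeeds iff it leaves a
  nonzero value in register 0.\<close>

definition init_state :: "nat \<Rightarrow> nat \<Rightarrow> nat \<Rightarrow> state" where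
  "init_state n m d = ((\<lambda>_. 0)(0 := n, 1 := m, 2 := d), \<lambda>_. 0)"

definition halts_within :: "com \<Rightarrow> nat \<Rightarrow> nat \<Rightarrow> nat \<Rightarrow> nat set set \<Rightarrow> nat game \<Rightarrow> nat \<Rightarrow> bool" where
  "halts_within P m d n E BR b \<longleftrightarrow>
     (\<exists>t s. exec (encode n E BR) P (init_state n m d) t s \<and> t \<le> b)"

definition succeeds :: "com \<Rightarrow> nat \<Rightarrow> nat \<Rightarrow> nat \<Rightarrow> nat set set \<Rightarrow> nat game \<Rightarrow> bool" where
  "succeeds P m d n E BR \<longleftrightarrow>
     (\<exists>t s. exec (encode n E BR) P (init_state n m d) t s \<and> fst s 0 \<noteq> 0)"

end

theory Submission
  imports Defs
begin

text \<open>An edge with endpoints \<open>u\<close> and \<open>v\<close> is blocked if, whatever the other neighbours play, \<open>u\<close> wants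
  to match \<open>v\<close> and \<open>v\<close> wants to differ from \<open>u\<close>, or vice versa; this rules out an equilibrium. It
  prescribes all random bits of the two players, in one of two ways. With \<open>a = 2 ^ (d\<^sub>u - 1)\<close> and
  \<open>b = 2 ^ (d\<^sub>v - 1)\<close> there are \<open>2a + 2b\<close> such bits, and \<open>2a + 2b - 1 \<le> 2ab + 1 \<le> 3ab\<close>, so the
  probability is at least \<open>8 ^ (- ab)\<close>. Disjoint edges are blocked independently. Whether an edge is
  blocked is decided by one pass over the two tables, and it suffices to do this for a greedy
  matching.\<close>

section \<open>Blocked edges\<close>

text \<open>A blocked edge is matching pennies in which both players ignore everyone else. The
  obstacle lies in the algorithm: it only builds a maximal matching, which may have half as many
  edges as a given family of \<open>m\<close> disjoint ones. The bounds for \<open>d\<close>-bounded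
  edges are therefore derived from the exact probability
  \<open>2 * (1 / 2) ^ (2 * a + 2 * b)\<close>, whose slack pays for the missing edges. The divisor
  \<open>2 * d\<close> in the second bound is the covering ratio of a maximal matching. On the
  machine side, the table of a player of a blocked edge is, up to negation, the exclusive or of two
  bits of the index, so its entries are predicted by flipping one register, without division or
  lookup of profiles. Stopping after \<open>m\<close> edges keeps the reading of tables within a
  multiple of \<open>m * 2 ^ d\<close>.\<close>

definition conforms :: "'a set set \<Rightarrow> 'a game \<Rightarrow> 'a \<Rightarrow> 'a \<Rightarrow> bool \<Rightarrow> bool" where
  "conforms E BR u v p \<longleftrightarrow>
     (\<forall>s. \<forall>\<tau> \<in> nbhd E u \<rightarrow>\<^sub>E UNIV. BR u s \<tau> \<longleftrightarrow> ((s = \<tau> v) = p))"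

text \<open>The roles of \<open>u\<close> and \<open>v\<close> differ; letting them range over both
  orderings of \<open>e\<close> covers the two ways of blocking.\<close>

definition blocked :: "'a set set \<Rightarrow> 'a game \<Rightarrow> 'a set \<Rightarrow> bool" where
  "blocked E BR e \<longleftrightarrow>
     (\<exists>u v. e = {u, v} \<and> conforms E BR u v True \<and> conforms E BR v u False)"

lemma blocked_no_PNE:
  assumes "simple_graph V E" "e \<in> E" "blocked E BR e"
  shows "\<not> has_PNE V E BR"
proof
  assume "has_PNE V E BR"
  then obtain \<sigma> where \<sigma>: "\<And>v. v \<in> V \<Longrightarrow> BR v (\<sigma> v) (restrict \<sigma> (nbhd E v))"
    by (auto simp: has_PNE_def is_PNE_def)
  from assms(3) obtain u v where e: "e = {u, v}"
    and c: "conforms E BR u v True" "conforms E BR v u False"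
    by (auto simp: blocked_def)
  have nb: "v \<in> nbhd E u" "u \<in> nbhd E v" "u \<in> V" "v \<in> V"
    using assms e by (auto simp: nbhd_def insert_commute simple_graph_def)
  have "\<sigma> u = \<sigma> v"
    using c(1) \<sigma>[OF nb(3)] nb by (auto simp: conforms_def)
  moreover have "\<sigma> v \<noteq> \<sigma> u"
    using c(2) \<sigma>[OF nb(4)] nb by (auto simp: conforms_def)
  ultimately show False by simp
qed

lemma nbhd_subset: "simple_graph V E \<Longrightarrow> nbhd E v \<subseteq> V"
  by (auto simp: simple_graph_def nbhd_def)

lemma finite_nbhd: "simple_graph V E \<Longrightarrow> finite (nbhd E v)"
  by (rule finite_subset[of _ V]) (simp_all add: nbhd_subset, simp add: simple_graph_def)

lemma simple_graph_finite_edges: "simple_graph V E \<Longrightarrow> finite E"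
  by (rule finite_subset[of E "Pow V"]) (auto simp: simple_graph_def)

lemma simple_graph_edgeE:
  assumes "simple_graph V E" "e \<in> E"
  obtains u v where "e = {u, v}" "u \<noteq> v" "u \<in> V" "v \<in> V" "v \<in> nbhd E u" "u \<in> nbhd E v"
proof -
  have "card e = 2" "e \<subseteq> V" using assms by (auto simp: simple_graph_def)
  then obtain u v where "e = {u, v}" "u \<noteq> v" by (auto simp: card_2_iff)
  then show ?thesis
    using that assms \<open>e \<subseteq> V\<close> by (auto simp: nbhd_def insert_commute)
qed

lemma card_profiles:
  assumes "finite A"
  shows "card (A \<rightarrow>\<^sub>E (UNIV :: bool set)) = 2 ^ card A"
  using assms by (simp add: card_PiE)

section \<open>The probability of blocked edges\<close>

lemma prob_pair_pmf_times:
  "measure_pmf.prob (pair_pmf M N) (A \<times> B) = measure_pmf.prob M A * measure_pmf.prob N B"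
proof -
  \<comment> \<open>Intersecting with the supports makes both factors countable, as the product rule
    below requires.\<close>
  have "measure_pmf.prob (pair_pmf M N) (A \<times> B)
      = measure_pmf.prob (pair_pmf M N) ((A \<inter> set_pmf M) \<times> (B \<inter> set_pmf N))"
    by (intro measure_prob_cong_0) (auto simp: pmf_pair set_pmf_iff)
  also have "\<dots> = measure_pmf.prob M (A \<inter> set_pmf M) * measure_pmf.prob N (B \<inter> set_pmf N)"
    by (intro measure_pmf_prob_product) (auto intro: countable_subset[OF _ countable_set_pmf])
  finally show ?thesis by (simp add: measure_Int_set_pmf)
qed

text \<open>A draw over \<open>A\<close> is a draw over \<open>B\<close> glued to an independent
  draw over \<open>A - B\<close>. As \<open>X\<close> and \<open>Y\<close> each see only one half,
  the preimage of \<open>X \<inter> Y\<close> under the gluing is the rectangle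
  \<open>X \<times> Y\<close>.\<close>

lemma Pi_pmf_prob_Int:
  assumes "finite A" "B \<subseteq> A"
    and X: "\<And>f g. (\<And>x. x \<in> B \<Longrightarrow> f x = g x) \<Longrightarrow> f \<in> X \<longleftrightarrow> g \<in> X"
    and Y: "\<And>f g. (\<And>x. x \<in> A - B \<Longrightarrow> f x = g x) \<Longrightarrow> f \<in> Y \<longleftrightarrow> g \<in> Y"
  shows "measure_pmf.prob (Pi_pmf A dflt p) (X \<inter> Y) =
    measure_pmf.prob (Pi_pmf A dflt p) X * measure_pmf.prob (Pi_pmf A dflt p) Y"
proof -
  let ?h = "\<lambda>(f, g) x. if x \<in> B then f x else g x"
  let ?P = "pair_pmf (Pi_pmf B dflt p) (Pi_pmf (A - B) dflt p)"
  have eq: "Pi_pmf A dflt p = map_pmf ?h ?P"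
    using Pi_pmf_union[of B "A - B" dflt p] assms(1,2) by (simp add: finite_subset Un_absorb1)
  have "?h (f, g) \<in> X \<longleftrightarrow> f \<in> X" for f g
    by (rule X) simp
  then have vX: "?h -` X = X \<times> UNIV"
    by auto
  have "?h (f, g) \<in> Y \<longleftrightarrow> g \<in> Y" for f g
    by (rule Y) simp
  then have vY: "?h -` Y = UNIV \<times> Y"
    by auto
  have "?h -` (X \<inter> Y) = X \<times> Y"
    unfolding vimage_Int vX vY by auto
  with vX vY show ?thesis
    unfolding eq measure_map_pmf by (simp add: prob_pair_pmf_times)
qed

text \<open>By disjointness the coordinates of all other events lie in \<open>A - B i\<close>, so
  the rule for two events splits off \<open>X i\<close>.\<close>

lemma Pi_pmf_prob_INT:
  assumes "finite A" "finite I"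
    and B: "\<And>i. i \<in> I \<Longrightarrow> B i \<subseteq> A" "disjoint_family_on B I"
    and X: "\<And>i f g. i \<in> I \<Longrightarrow> (\<And>x. x \<in> B i \<Longrightarrow> f x = g x) \<Longrightarrow> f \<in> X i \<longleftrightarrow> g \<in> X i"
  shows "measure_pmf.prob (Pi_pmf A dflt p) (\<Inter>i\<in>I. X i) =
    (\<Prod>i\<in>I. measure_pmf.prob (Pi_pmf A dflt p) (X i))"
  using assms(2) B X
proof (induction I rule: finite_induct)
  case (insert i I)
  have disj: "x \<notin> B i" if "j \<in> I" "x \<in> B j" for x j
    using insert.prems(2) insert.hyps that
    by (auto simp: disjoint_family_on_def)
  have "measure_pmf.prob (Pi_pmf A dflt p) (X i \<inter> (\<Inter>i\<in>I. X i)) =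
      measure_pmf.prob (Pi_pmf A dflt p) (X i) * measure_pmf.prob (Pi_pmf A dflt p) (\<Inter>i\<in>I. X i)"
  proof (rule Pi_pmf_prob_Int[OF assms(1), of "B i"])
    fix f g :: "'a \<Rightarrow> 'c" assume fg: "\<And>x. x \<in> A - B i \<Longrightarrow> f x = g x"
    have "f \<in> X j \<longleftrightarrow> g \<in> X j" if "j \<in> I" for j
    proof (rule insert.prems(3))
      show "f x = g x" if "x \<in> B j" for x
        using fg disj[OF \<open>j \<in> I\<close> that] insert.prems(1)[of j] \<open>j \<in> I\<close> that by blast
    qed (use that in simp)
    then show "f \<in> (\<Inter>i\<in>I. X i) \<longleftrightarrow> g \<in> (\<Inter>i\<in>I. X i)" by auto
  next
    show "B i \<subseteq> A" using insert.prems(1) by simp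
    show "f \<in> X i \<longleftrightarrow> g \<in> X i" if "\<And>x. x \<in> B i \<Longrightarrow> f x = g x" for f g
      using insert.prems(3)[of i f g] that by simp
  qed
  moreover have "measure_pmf.prob (Pi_pmf A dflt p) (\<Inter>i\<in>I. X i) =
      (\<Prod>i\<in>I. measure_pmf.prob (Pi_pmf A dflt p) (X i))"
  proof (rule insert.IH)
    show "B j \<subseteq> A" if "j \<in> I" for j using insert.prems(1) that by simp
    show "disjoint_family_on B I" using insert.prems(2) by (auto simp: disjoint_family_on_def)
    show "f \<in> X j \<longleftrightarrow> g \<in> X j" if "j \<in> I" "\<And>x. x \<in> B j \<Longrightarrow> f x = g x" for j f g
      using insert.prems(3)[of j f g] that by simp
  qed
  ultimately show ?case using insert.hyps by simp
qed simp

lemma Pi_pmf_fair_bits_prob: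
  assumes "finite A" "B \<subseteq> A"
  shows "measure_pmf.prob (Pi_pmf A dflt (\<lambda>_. pmf_of_set (UNIV :: bool set))) {f. \<forall>x\<in>B. f x = h x}
    = (1 / 2) ^ card B"
proof -
  let ?S = "\<lambda>x. if x \<in> B then {h x} else UNIV"
  have "{f. \<forall>x\<in>B. f x = h x} = Pi A ?S"
    using assms(2) by (auto simp: Pi_def)
  then have "measure_pmf.prob (Pi_pmf A dflt (\<lambda>_. pmf_of_set UNIV)) {f. \<forall>x\<in>B. f x = h x}
      = (\<Prod>x\<in>A. measure_pmf.prob (pmf_of_set UNIV) (?S x))"
    using assms(1) by (simp only: measure_Pi_pmf_Pi)
  also have "\<dots> = (\<Prod>x\<in>A. if x \<in> B then 1 / 2 else 1)"
    by (intro prod.cong) (auto simp: measure_pmf_single)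
  also have "\<dots> = (\<Prod>x\<in>B. 1 / 2)"
    using assms by (intro prod.mono_neutral_cong_right) auto
  finally show ?thesis by simp
qed

text \<open>For \<open>e = V\<close> this indexes all bits of the random game, for an edge the bits
  of its two players. Disjoint vertex sets own disjoint bits, which is the source of
  independence.\<close>

definition own_bits :: "'a set set \<Rightarrow> 'a set \<Rightarrow> ('a \<times> ('a \<Rightarrow> bool)) set" where
  "own_bits E e = (SIGMA v:e. nbhd E v \<rightarrow>\<^sub>E UNIV)"

definition game_of_bits :: "('a \<times> ('a \<Rightarrow> bool) \<Rightarrow> bool) \<Rightarrow> 'a game" where
  "game_of_bits f v s \<tau> = (if s then \<not> f (v, \<tau>) else f (v, \<tau>))"

lemma random_game_conv:
  "random_game V E = map_pmf game_of_bits (Pi_pmf (own_bits E V) False (\<lambda>_. pmf_of_set UNIV))"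
  by (simp add: random_game_def own_bits_def game_of_bits_def[abs_def])

text \<open>Passing from strategy 0 to 1 negates both the drawn entry and the prescribed one, so the
  two conditions on a profile coincide and each bit is constrained once.\<close>

lemma conforms_game_of_bits:
  "conforms E (game_of_bits f) u v p \<longleftrightarrow>
    (\<forall>\<tau> \<in> nbhd E u \<rightarrow>\<^sub>E UNIV. f (u, \<tau>) \<longleftrightarrow> ((\<not> \<tau> v) = p))"
proof -
  have "(game_of_bits f u s \<tau> \<longleftrightarrow> ((s = \<tau> v) = p)) \<longleftrightarrow> (f (u, \<tau>) \<longleftrightarrow> ((\<not> \<tau> v) = p))" for s \<tau>
    by (cases s; cases "\<tau> v"; cases p) (simp_all add: game_of_bits_def)
  then show ?thesis by (simp add: conforms_def)
qed

lemma blocked_game_of_bits_cong: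
  assumes "\<And>x. x \<in> own_bits E e \<Longrightarrow> f x = g x"
  shows "blocked E (game_of_bits f) e \<longleftrightarrow> blocked E (game_of_bits g) e"
proof -
  have "conforms E (game_of_bits f) u v p \<longleftrightarrow> conforms E (game_of_bits g) u v p" if "u \<in> e" for u v p
    using assms that by (auto simp: conforms_game_of_bits own_bits_def)
  then show ?thesis unfolding blocked_def by (metis insertCI)
qed

lemma finite_own_bits: "simple_graph V E \<Longrightarrow> finite e \<Longrightarrow> finite (own_bits E e)"
  unfolding own_bits_def by (intro finite_SigmaI finite_PiE) (auto simp: finite_nbhd)

text \<open>Player \<open>v\<close> owns \<open>2 ^ degree E v\<close> bits, all of them prescribed;
  the leading 2 counts the two mutually exclusive patterns.\<close>

definition block_prob :: "'a set set \<Rightarrow> 'a set \<Rightarrow> real" where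
  "block_prob E e = 2 * (1 / 2) ^ (\<Sum>v\<in>e. 2 ^ degree E v)"

lemma prob_blocked:
  assumes G: "simple_graph V E" and e: "e \<in> E"
  shows "measure_pmf.prob (random_game V E) {BR. blocked E BR e} = block_prob E e"
proof -
  obtain u v where uv: "e = {u, v}" "u \<noteq> v" "u \<in> V" "v \<in> V" "v \<in> nbhd E u" "u \<in> nbhd E v"
    using simple_graph_edgeE[OF G e] .
  let ?P = "Pi_pmf (own_bits E V) False (\<lambda>_. pmf_of_set (UNIV :: bool set))"
  \<comment> \<open>On the bits of the edge, \<open>h p\<close> is the only pattern for which
    \<open>u\<close> conforms with \<open>p\<close> and \<open>v\<close> with
    \<open>\<not> p\<close>.\<close>
  define h where "h = (\<lambda>p. \<lambda>(w :: 'a, \<tau>). if w = u then (\<not> \<tau> v) = p else (\<not> \<tau> u) \<noteq> p)"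
  define X where "X = (\<lambda>p. {f :: 'a \<times> ('a \<Rightarrow> bool) \<Rightarrow> bool. \<forall>x\<in>own_bits E e. f x = h p x})"
  have fV: "finite V" using G by (simp add: simple_graph_def)
  have card: "card (own_bits E e) = (\<Sum>v\<in>e. 2 ^ degree E v)"
    using G uv(1) unfolding own_bits_def
    by (subst card_SigmaI) (auto simp: degree_def card_profiles finite_nbhd finite_PiE)
  have prob: "measure_pmf.prob ?P (X p) = (1 / 2) ^ (\<Sum>v\<in>e. 2 ^ degree E v)" for p
    unfolding X_def card[symmetric]
    by (rule Pi_pmf_fair_bits_prob[OF finite_own_bits[OF G fV]])
      (use uv in \<open>auto simp: own_bits_def\<close>)
  have X_iff: "conforms E (game_of_bits f) u v p \<and> conforms E (game_of_bits f) v u (\<not> p) \<longleftrightarrow> f \<in> X p"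
    for f p
    using uv(2) by (auto simp: X_def h_def uv(1) own_bits_def conforms_game_of_bits)
  have "blocked E (game_of_bits f) e \<longleftrightarrow> f \<in> X True \<union> X False" for f
    unfolding Un_iff X_iff[symmetric] unfolding blocked_def uv(1)
    by (auto simp: doubleton_eq_iff)
  then have "game_of_bits -` {BR. blocked E BR e} = X True \<union> X False"
    by auto
  moreover have "X True \<inter> X False = {}"
  proof -
    \<comment> \<open>The patterns \<open>h True\<close> and \<open>h False\<close> differ in every
      bit, so any single bit of \<open>u\<close> separates them.\<close>
    have "(u, \<lambda>w\<in>nbhd E u. False) \<in> own_bits E e"
      using uv by (auto simp: own_bits_def)
    then show ?thesis
      unfolding X_def h_def by fastforce
  qed
  ultimately show ?thesis
    unfolding random_game_conv measure_map_pmf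
    by (simp add: measure_pmf.finite_measure_Union prob block_prob_def)
qed

lemma independent_edges_finite:
  "simple_graph V E \<Longrightarrow> independent_edges E S \<Longrightarrow> finite S"
  using simple_graph_finite_edges finite_subset by (auto simp: independent_edges_def)

lemma prob_some_blocked:
  assumes G: "simple_graph V E" and S: "independent_edges E S"
  shows "measure_pmf.prob (random_game V E) {BR. \<exists>e\<in>S. blocked E BR e} = 1 - (\<Prod>e\<in>S. 1 - block_prob E e)"
proof -
  let ?P = "Pi_pmf (own_bits E V) False (\<lambda>_. pmf_of_set (UNIV :: bool set))"
  let ?X = "\<lambda>e. {f. \<not> blocked E (game_of_bits f) e}"
  have SE: "S \<subseteq> E" and disj: "pairwise disjnt S" using S by (auto simp: independent_edges_def)
  have *: "measure_pmf.prob ?P (?X e) = 1 - block_prob E e" if "e \<in> S" for e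
  proof -
    have "measure_pmf.prob ?P (- {f. blocked E (game_of_bits f) e}) = 1 - block_prob E e"
      using prob_blocked[OF G, of e] SE that
      by (subst measure_pmf.prob_compl[simplified, unfolded Compl_eq_Diff_UNIV[symmetric]])
        (auto simp: random_game_conv)
    then show ?thesis by (simp add: Collect_neg_eq)
  qed
  have "measure_pmf.prob ?P (\<Inter>e\<in>S. ?X e) = (\<Prod>e\<in>S. measure_pmf.prob ?P (?X e))"
  proof (rule Pi_pmf_prob_INT[where B = "own_bits E"])
    show "finite (own_bits E V)" using finite_own_bits[OF G] G by (simp add: simple_graph_def)
    show "finite S" using independent_edges_finite[OF G S] .
    show "own_bits E e \<subseteq> own_bits E V" if "e \<in> S" for e
      using G SE that by (auto simp: own_bits_def simple_graph_def)
    show "disjoint_family_on (own_bits E) S"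
      using disj by (force simp: disjoint_family_on_def own_bits_def pairwise_def disjnt_def)
    show "f \<in> ?X e \<longleftrightarrow> g \<in> ?X e" if "e \<in> S" "\<And>x. x \<in> own_bits E e \<Longrightarrow> f x = g x" for e f g
      using blocked_game_of_bits_cong[of E e f g] that by simp
  qed
  also have "\<dots> = (\<Prod>e\<in>S. 1 - block_prob E e)"
    using * by (rule prod.cong[OF refl])
  finally have **: "measure_pmf.prob ?P (\<Inter>e\<in>S. ?X e) = (\<Prod>e\<in>S. 1 - block_prob E e)" .
  have "game_of_bits -` {BR. \<exists>e\<in>S. blocked E BR e} = - (\<Inter>e\<in>S. ?X e)"
    by auto
  then show ?thesis
    unfolding random_game_conv measure_map_pmf **[symmetric]
    by (simp add: measure_pmf.prob_compl[simplified] Compl_eq_Diff_UNIV)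
qed

section \<open>Comparison of the exact blocking probability with the stated bounds\<close>

lemma degree_pos:
  assumes "simple_graph V E" "u \<in> nbhd E v"
  shows "1 \<le> degree E v"
  using assms finite_nbhd[of V E v] by (auto simp: degree_def Suc_le_eq card_gt_0_iff)

lemma edge_prob_le_block_prob:
  assumes G: "simple_graph V E" and e: "e \<in> E"
  shows "edge_prob E e \<le> block_prob E e"
proof -
  obtain u v where uv: "e = {u, v}" "u \<noteq> v" "u \<in> V" "v \<in> V" "v \<in> nbhd E u" "u \<in> nbhd E v"
    by (rule simple_graph_edgeE[OF G e])
  \<comment> \<open>Degrees are at least 1, so the truncated \<open>- 2\<close> in
    \<open>edge_prob\<close> is exact: the exponent is \<open>i + j\<close>, and the players own
    \<open>2 * a\<close> and \<open>2 * b\<close> bits.\<close>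
  obtain i j where ij: "degree E u = Suc i" "degree E v = Suc j"
    using degree_pos[OF G uv(5)] degree_pos[OF G uv(6)] by (metis not_less_eq_eq One_nat_def Suc_le_D)
  define a b :: nat where "a = 2 ^ i" and "b = 2 ^ j"
  have "1 \<le> a" "1 \<le> b" by (simp_all add: a_def b_def)
  \<comment> \<open>Expanded, this is \<open>a + b \<le> a * b + 1\<close>; the integers avoid
    truncated subtraction.\<close>
  then have "0 \<le> (int a - 1) * (int b - 1)" by simp
  then have ab: "a + b \<le> a * b + 1"
    by (simp add: algebra_simps flip: of_nat_mult of_nat_add)
  have "edge_prob E e = (1 / 2) ^ (3 * (a * b))"
    using uv ij by (simp add: edge_prob_def a_def b_def power_mult power_one_over flip: power_add)
  also have "\<dots> \<le> (1 / 2) ^ (2 * a + 2 * b - 1)"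
    using ab \<open>1 \<le> a\<close> \<open>1 \<le> b\<close> by (intro power_decreasing) auto
  also have "\<dots> = 2 * (1 / 2) ^ (2 * a + 2 * b)"
    using \<open>1 \<le> a\<close> by (cases "2 * a + 2 * b") auto
  also have "\<dots> = block_prob E e"
    using uv ij by (simp add: block_prob_def a_def b_def)
  finally show ?thesis .
qed

lemma edge_prob_less_1: "edge_prob E e < 1"
  by (simp add: edge_prob_def)

lemma block_prob_le_1:
  assumes G: "simple_graph V E" and e: "e \<in> E"
  shows "block_prob E e \<le> 1"
  using prob_blocked[OF G e] measure_pmf.prob_le_1 by metis

text \<open>Rests on \<open>1 - t \<le> exp (- t)\<close>. The parameters \<open>q\<close> and
  \<open>x\<close> stay free so that a deficit in \<open>card S\<close> can be traded against a
  surplus in \<open>q\<close>.\<close>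

lemma prod_one_minus_block_prob_le:
  assumes G: "simple_graph V E" and S: "independent_edges E S"
    and q: "\<And>e. e \<in> S \<Longrightarrow> q \<le> block_prob E e" and x: "x \<le> real (card S) * q"
  shows "1 - exp (- x) \<le> 1 - (\<Prod>e\<in>S. 1 - block_prob E e)"
proof -
  have SE: "S \<subseteq> E" using S by (auto simp: independent_edges_def)
  have "(\<Prod>e\<in>S. 1 - block_prob E e) \<le> (\<Prod>e\<in>S. exp (- q))"
  proof (rule prod_mono)
    fix e assume "e \<in> S"
    moreover have "1 + (- block_prob E e) \<le> exp (- block_prob E e)" by (rule exp_ge_add_one_self)
    moreover have "exp (- block_prob E e) \<le> exp (- q)" using q[OF \<open>e \<in> S\<close>] by simp
    moreover have "block_prob E e \<le> 1" using block_prob_le_1[OF G, of e] SE \<open>e \<in> S\<close> by blast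
    ultimately show "0 \<le> 1 - block_prob E e \<and> 1 - block_prob E e \<le> exp (- q)"
      by linarith
  qed
  also have "\<dots> = exp (- (real (card S) * q))"
    by (simp flip: exp_of_nat_mult)
  also have "\<dots> \<le> exp (- x)" using x by simp
  finally show ?thesis by simp
qed

text \<open>The worst case has both degrees equal to \<open>d\<close>, hence
  \<open>2 ^ d + 2 ^ d\<close> bits. The leading 2 is kept: for \<open>d = 1\<close> it gives
  exactly 1/8, for larger \<open>d\<close> it helps to pay for edges missed by a greedy
  matching.\<close>

lemma block_prob_bounded_edge:
  assumes G: "simple_graph V E" and e: "e \<in> bounded_edges E d"
  shows "2 * (1 / 2) ^ (2 ^ (d + 1)) \<le> block_prob E e"
proof -
  have eE: "e \<in> E" using e by (simp add: bounded_edges_def)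
  obtain u v where uv: "e = {u, v}" "u \<noteq> v" "u \<in> V" "v \<in> V" "v \<in> nbhd E u" "u \<in> nbhd E v"
    by (rule simple_graph_edgeE[OF G eE])
  have "(2::nat) ^ degree E u \<le> 2 ^ d" "(2::nat) ^ degree E v \<le> 2 ^ d"
    using e uv by (auto simp: bounded_edges_def)
  then have "(\<Sum>v\<in>e. 2 ^ degree E v) \<le> (2 ^ (d + 1) :: nat)"
    unfolding uv(1) using uv(2) by (simp del: power_increasing_iff)
  then show ?thesis
    unfolding block_prob_def by (intro mult_left_mono power_decreasing) auto
qed

text \<open>With \<open>a = 2 ^ (d - 1)\<close> the exponents to compare are
  \<open>3 * a ^ 2\<close> and \<open>4 * a\<close>. From \<open>a = 2\<close> on the former is the
  larger, which leaves room for a factor 2 on the left; for \<open>a = 1\<close> both sides of the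
  first claim equal 1/8 and nothing is left over.\<close>

lemma eighth_power_le:
  assumes "1 \<le> d"
  shows "(1 / 8) ^ (2 ^ (2 * d - 2)) \<le> (2 * (1 / 2) ^ (2 ^ (d + 1)) :: real)"
    and "2 \<le> d \<Longrightarrow> 2 * (1 / 8) ^ (2 ^ (2 * d - 2)) \<le> (2 * (1 / 2) ^ (2 ^ (d + 1)) :: real)"
proof -
  obtain k where d: "d = Suc k" using assms by (cases d) auto
  define a :: nat where "a = 2 ^ k"
  have eq: "(1 / 8 :: real) ^ (2 ^ (2 * d - 2)) = (1 / 2) ^ (3 * a ^ 2)"
    by (simp add: d a_def power_one_over power_mult mult.commute[of k] power2_eq_square
        flip: power_mult_distrib)
  have eq2: "(2::nat) ^ (d + 1) = 4 * a" by (simp add: d a_def)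
  show *: "2 * (1 / 8) ^ (2 ^ (2 * d - 2)) \<le> (2 * (1 / 2) ^ (2 ^ (d + 1)) :: real)" if "2 \<le> d"
  proof -
    have "2 ^ 1 \<le> a" unfolding a_def using that d by (intro power_increasing) auto
    then have "2 * a \<le> a * a" by simp
    then have "4 * a \<le> 3 * a ^ 2" unfolding power2_eq_square by linarith
    then show ?thesis
      unfolding eq eq2 by (intro mult_left_mono power_decreasing) auto
  qed
  show "(1 / 8) ^ (2 ^ (2 * d - 2)) \<le> (2 * (1 / 2) ^ (2 ^ (d + 1)) :: real)"
  proof (cases "2 \<le> d")
    case True
    have "(1 / 8) ^ (2 ^ (2 * d - 2)) \<le> (2 * (1 / 8) ^ (2 ^ (2 * d - 2)) :: real)" by simp
    then show ?thesis using *[OF True] by linarith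
  next
    case False
    then have "d = 1" using assms by simp
    then show ?thesis by (simp add: power_one_over)
  qed
qed

section \<open>Maximal matchings of bounded edges\<close>

definition maximal_matching :: "'a set set \<Rightarrow> nat \<Rightarrow> 'a set set \<Rightarrow> bool" where
  "maximal_matching E d M \<longleftrightarrow> independent_edges E M \<and> M \<subseteq> bounded_edges E d \<and>
     (\<forall>e\<in>bounded_edges E d. e \<inter> \<Union>M \<noteq> {})"

lemma maximal_matching_exists:
  assumes G: "simple_graph V E"
  obtains M where "maximal_matching E d M"
proof -
  let ?\<C> = "{M. independent_edges E M \<and> M \<subseteq> bounded_edges E d}"
  have "finite ?\<C>"
    by (rule finite_subset[of _ "Pow E"])
      (use simple_graph_finite_edges[OF G] in \<open>auto simp: independent_edges_def\<close>)
  moreover have "{} \<in> ?\<C>" by (auto simp: independent_edges_def)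
  ultimately obtain M where M: "M \<in> ?\<C>" and max: "\<And>N. N \<in> ?\<C> \<Longrightarrow> M \<subseteq> N \<Longrightarrow> M = N"
    using finite_has_maximal[of ?\<C>] by (metis (no_types, lifting) empty_iff)
  have "e \<inter> \<Union>M \<noteq> {}" if e: "e \<in> bounded_edges E d" for e
  proof
    assume *: "e \<inter> \<Union>M = {}"
    have "insert e M \<in> ?\<C>"
      using M e * by (auto simp: independent_edges_def pairwise_insert disjnt_def bounded_edges_def)
    then have "e \<in> M" using max[of "insert e M"] by auto
    then have "e = {}" using * by auto
    moreover have "card e = 2" using G e by (auto simp: simple_graph_def bounded_edges_def)
    ultimately show False by simp
  qed
  then have "maximal_matching E d M" using M by (simp add: maximal_matching_def)
  then show ?thesis by (rule that)
qed

lemma card_Union_edges: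
  assumes "simple_graph V E" "M \<subseteq> E"
  shows "card (\<Union>M) \<le> 2 * card M"
proof -
  have "card (\<Union>M) \<le> (\<Sum>e\<in>M. card e)" by (rule card_Union_le_sum_card)
  also have "\<dots> = (\<Sum>e\<in>M. 2)" using assms by (intro sum.cong) (auto simp: simple_graph_def)
  finally show ?thesis by simp
qed

lemma finite_Union_edges: "simple_graph V E \<Longrightarrow> M \<subseteq> E \<Longrightarrow> finite (\<Union>M)"
  by (rule finite_subset[of _ V]) (auto simp: simple_graph_def)

text \<open>Choosing for each edge of \<open>S\<close> a point where it meets
  \<open>\<Union>M\<close> is injective, as the edges of \<open>S\<close> are disjoint, and
  \<open>M\<close> covers at most \<open>2 * card M\<close> vertices.\<close>

lemma card_independent_le_maximal_matching:
  assumes G: "simple_graph V E" and M: "maximal_matching E d M"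
    and S: "independent_edges E S" "S \<subseteq> bounded_edges E d"
  shows "card S \<le> 2 * card M"
proof -
  have ME: "M \<subseteq> E" using M by (auto simp: maximal_matching_def independent_edges_def)
  define g where "g = (\<lambda>e. SOME x. x \<in> e \<inter> \<Union>M)"
  have g: "g e \<in> e \<inter> \<Union>M" if "e \<in> S" for e
    unfolding g_def by (rule someI_ex) (use M S that in \<open>unfold maximal_matching_def, blast\<close>)
  have "inj_on g S"
  proof (rule inj_onI, rule ccontr)
    fix e f assume "e \<in> S" "f \<in> S" "g e = g f" "e \<noteq> f"
    then have "e \<inter> f = {}" using S(1) by (auto simp: independent_edges_def pairwise_def disjnt_def)
    moreover have "g e \<in> e" "g f \<in> f" using g \<open>e \<in> S\<close> \<open>f \<in> S\<close> by blast+
    ultimately show False using \<open>g e = g f\<close> by auto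
  qed
  then have "card S \<le> card (\<Union>M)"
    using g finite_Union_edges[OF G ME] by (intro card_inj_on_le[of g]) blast+
  then show ?thesis using card_Union_edges[OF G ME] by linarith
qed

lemma card_incident_edges:
  assumes "simple_graph V E"
  shows "card {e \<in> E. x \<in> e} \<le> degree E x"
  unfolding degree_def
proof (rule surj_card_le[where f = "\<lambda>y. {y, x}"])
  show "finite (nbhd E x)" using finite_nbhd[OF assms] .
  show "{e \<in> E. x \<in> e} \<subseteq> (\<lambda>y. {y, x}) ` nbhd E x"
  proof
    fix e assume e: "e \<in> {e \<in> E. x \<in> e}"
    then have "e \<in> E" by simp
    then obtain u v where "e = {u, v}" "u \<noteq> v" "u \<in> V" "v \<in> V" "v \<in> nbhd E u" "u \<in> nbhd E v"
      by (rule simple_graph_edgeE[OF assms])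
    then show "e \<in> (\<lambda>y. {y, x}) ` nbhd E x" using e by (auto simp: insert_commute)
  qed
qed

text \<open>Every bounded edge contains one of the at most \<open>2 * card M\<close> covered
  vertices, each of degree at most \<open>d\<close>: the origin of the divisor
  \<open>2 * d\<close>.\<close>

lemma card_bounded_edges_le_maximal_matching:
  assumes G: "simple_graph V E" and M: "maximal_matching E d M"
  shows "card (bounded_edges E d) \<le> 2 * d * card M"
proof -
  have ME: "M \<subseteq> E" using M by (auto simp: maximal_matching_def independent_edges_def)
  have "bounded_edges E d \<subseteq> (\<Union>x\<in>\<Union>M. {e \<in> E. x \<in> e})"
    using M by (auto simp: maximal_matching_def bounded_edges_def)
  then have "card (bounded_edges E d) \<le> card (\<Union>x\<in>\<Union>M. {e \<in> E. x \<in> e})"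
    using finite_Union_edges[OF G ME] simple_graph_finite_edges[OF G]
    by (intro card_mono finite_UN_I) auto
  also have "\<dots> \<le> (\<Sum>x\<in>\<Union>M. card {e \<in> E. x \<in> e})"
    using finite_Union_edges[OF G ME] by (rule card_UN_le)
  also have "\<dots> \<le> (\<Sum>x\<in>\<Union>M. d)"
  proof (rule sum_mono)
    fix x assume "x \<in> \<Union>M"
    then have "degree E x \<le> d" using M by (auto simp: maximal_matching_def bounded_edges_def)
    then show "card {e \<in> E. x \<in> e} \<le> d" using card_incident_edges[OF G, of x] by linarith
  qed
  also have "\<dots> \<le> 2 * card M * d"
    using card_Union_edges[OF G ME] by simp
  finally show ?thesis by (simp add: mult_ac)
qed

text \<open>A vertex of degree at most 1 lies on at most one edge, so a bounded edge that meets an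
  edge of \<open>M\<close> is that edge.\<close>

lemma maximal_matching_degree_1:
  assumes G: "simple_graph V E" and M: "maximal_matching E 1 M"
  shows "bounded_edges E 1 \<subseteq> M"
proof
  fix e assume e: "e \<in> bounded_edges E 1"
  then have "e \<inter> \<Union>M \<noteq> {}" using M by (simp add: maximal_matching_def)
  then obtain f x where f: "f \<in> M" "x \<in> e" "x \<in> f" by blast
  have "f \<in> E" "e \<in> E" using f M e by (auto simp: maximal_matching_def bounded_edges_def)
  have "card {e \<in> E. x \<in> e} \<le> 1"
    using card_incident_edges[OF G, of x] e f by (auto simp: bounded_edges_def)
  moreover have "finite {e \<in> E. x \<in> e}" using simple_graph_finite_edges[OF G] by simp
  ultimately have "\<forall>a\<in>{e \<in> E. x \<in> e}. \<forall>b\<in>{e \<in> E. x \<in> e}. a = b"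
    by (simp add: card_le_Suc0_iff_eq)
  then have "e = f"
    using f \<open>f \<in> E\<close> \<open>e \<in> E\<close> by blast
  then show "e \<in> M" using f by simp
qed

text \<open>A greedy matching may miss half of the available edges. For \<open>d \<ge> 2\<close> the factor 2 is made up
  for by the exact value of the blocking probability, for \<open>d = 1\<close> nothing is missed.\<close>

lemma prob_blocked_greedy_matching:
  assumes G: "simple_graph V E" and d: "1 \<le> d"
    and M: "independent_edges E M" "M \<subseteq> bounded_edges E d"
    and large: "m \<le> card M \<or> maximal_matching E d M"
  defines "pr \<equiv> measure_pmf.prob (random_game V E) {BR. \<exists>e\<in>M. blocked E BR e}"
  shows "(\<exists>S. independent_edges E S \<and> S \<subseteq> bounded_edges E d \<and> m \<le> card S) \<Longrightarrow>
      1 - exp (- (real m * (1 / 8) ^ (2 ^ (2 * d - 2)))) \<le> pr"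
    and "m \<le> card (bounded_edges E d) \<Longrightarrow>
      1 - exp (- (real m / (2 * real d) * (1 / 8) ^ (2 ^ (2 * d - 2)))) \<le> pr"
proof -
  define p :: real where "p = (1 / 8) ^ (2 ^ (2 * d - 2))"
  define q :: real where "q = 2 * (1 / 2) ^ (2 ^ (d + 1))"
  have p: "0 \<le> p" "p \<le> q" using eighth_power_le(1)[OF d] by (simp_all add: p_def q_def)
  have fin: "finite M" using M independent_edges_finite[OF G] by blast
  \<comment> \<open>Both claims now reduce to comparing \<open>card M * q\<close> with
    \<open>m * p\<close> and with \<open>m / (2 * d) * p\<close>.\<close>
  have *: "1 - exp (- x) \<le> pr" if "x \<le> real (card M) * q" for x
    unfolding pr_def prob_some_blocked[OF G M(1)]
    using that M block_prob_bounded_edge[OF G]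
    by (intro prod_one_minus_block_prob_le[OF G M(1)]) (auto simp: q_def)
  show "1 - exp (- (real m * (1 / 8) ^ (2 ^ (2 * d - 2)))) \<le> pr"
    if "\<exists>S. independent_edges E S \<and> S \<subseteq> bounded_edges E d \<and> m \<le> card S"
  proof -
    from that obtain S where S: "independent_edges E S" "S \<subseteq> bounded_edges E d" "m \<le> card S" by blast
    have "real m * p \<le> real (card M) * q"
    proof (cases "m \<le> card M")
      case True
      then show ?thesis using p by (intro mult_mono) auto
    next
      case False
      then have max: "maximal_matching E d M" using large by simp
      show ?thesis
      proof (cases "d = 1")
        case True
        then have "card S \<le> card M"
          using maximal_matching_degree_1[OF G] max S fin by (intro card_mono) auto
        then show ?thesis using False S by linarith
      next
        case False
        then have "2 * p \<le> q"
          using eighth_power_le(2)[OF d] d by (simp add: p_def q_def)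
        moreover have "real m \<le> real (card M) * 2"
          using card_independent_le_maximal_matching[OF G max S(1,2)] S(3) by linarith
        ultimately have "real m * p \<le> real (card M) * 2 * p" "real (card M) * (2 * p) \<le> real (card M) * q"
          using p by (auto intro: mult_right_mono mult_left_mono)
        then show ?thesis by linarith
      qed
    qed
    then show ?thesis using * by (simp add: p_def)
  qed
  show "1 - exp (- (real m / (2 * real d) * (1 / 8) ^ (2 ^ (2 * d - 2)))) \<le> pr"
    if "m \<le> card (bounded_edges E d)"
  proof -
    have "m \<le> 2 * d * card M"
    proof (cases "m \<le> card M")
      case True
      also have "card M \<le> 2 * d * card M" using d by simp
      finally show ?thesis .
    next
      case False
      then show ?thesis
        using card_bounded_edges_le_maximal_matching[OF G] large that by fastforce
    qed
    then have "real m \<le> real (card M) * (2 * real d)"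
      by (metis of_nat_le_iff of_nat_mult of_nat_numeral mult.commute)
    then have "real m / (2 * real d) \<le> real (card M)"
      using d by (simp add: pos_divide_le_eq)
    then have "real m / (2 * real d) * p \<le> real (card M) * q"
      using p by (intro mult_mono) auto
    then show ?thesis using * by (simp add: p_def)
  qed
qed

section \<open>Lower bounds for the absence of equilibria\<close>

lemma prob_no_PNE_ge_prob_blocked:
  assumes "simple_graph V E" "S \<subseteq> E"
  shows "measure_pmf.prob (random_game V E) {BR. \<exists>e\<in>S. blocked E BR e}
    \<le> measure_pmf.prob (random_game V E) {BR. \<not> has_PNE V E BR}"
  using assms(2) blocked_no_PNE[OF assms(1)] by (intro measure_pmf.finite_measure_mono) auto

text \<open>The bound for greedy matchings is applied to \<open>S\<close> itself, which satisfies
  \<open>large\<close> through the first alternative.\<close>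

lemma prob_no_PNE_disjoint_edges:
  assumes G: "simple_graph V E" and d: "1 \<le> d"
    and S: "independent_edges E S" "S \<subseteq> bounded_edges E d" "m \<le> card S"
  shows "1 - exp (- (real m * (1 / 8) ^ (2 ^ (2 * d - 2))))
    \<le> measure_pmf.prob (random_game V E) {BR. \<not> has_PNE V E BR}"
proof -
  have "S \<subseteq> E" using S by (auto simp: independent_edges_def)
  then show ?thesis
    using prob_blocked_greedy_matching(1)[OF G d S(1,2), of m] S prob_no_PNE_ge_prob_blocked[OF G, of S]
    by (meson order_trans)
qed

lemma prob_no_PNE_bounded_edges:
  assumes G: "simple_graph V E" and d: "1 \<le> d" and m: "m \<le> card (bounded_edges E d)"
  shows "1 - exp (- (real m / (2 * real d) * (1 / 8) ^ (2 ^ (2 * d - 2))))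
    \<le> measure_pmf.prob (random_game V E) {BR. \<not> has_PNE V E BR}"
proof -
  obtain M where M: "maximal_matching E d M" using maximal_matching_exists[OF G] .
  then have "independent_edges E M" "M \<subseteq> bounded_edges E d" "M \<subseteq> E"
    by (auto simp: maximal_matching_def independent_edges_def)
  then show ?thesis
    using prob_blocked_greedy_matching(2)[OF G d _ _ _ m, of M] M prob_no_PNE_ge_prob_blocked[OF G, of M]
    by (meson order_trans)
qed

text \<open>Since \<open>edge_prob\<close> is below 1, \<open>exp\<close> undoes the logarithms and
  turns the sum of weights into the product of the factors \<open>1 - edge_prob E e\<close>.\<close>

lemma prob_no_PNE_weights:
  assumes G: "simple_graph V E" and S: "independent_edges E S"
  shows "1 - exp (- sum (edge_weight E) S)
    \<le> measure_pmf.prob (random_game V E) {BR. \<not> has_PNE V E BR}"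
proof -
  have SE: "S \<subseteq> E" using S by (auto simp: independent_edges_def)
  have "exp (- sum (edge_weight E) S) = (\<Prod>e\<in>S. 1 - edge_prob E e)"
    using edge_prob_less_1[of E] independent_edges_finite[OF G S]
    by (simp add: edge_weight_def sum_negf exp_sum)
  moreover have "(\<Prod>e\<in>S. 1 - block_prob E e) \<le> (\<Prod>e\<in>S. 1 - edge_prob E e)"
    using SE edge_prob_le_block_prob[OF G] block_prob_le_1[OF G]
    by (intro prod_mono) auto
  ultimately show ?thesis
    using prob_no_PNE_ge_prob_blocked[OF G SE] prob_some_blocked[OF G S] by linarith
qed

section \<open>Weakest preconditions with running time\<close>

text \<open>Total correctness: a halting run is asserted, and its number of steps is passed to the
  postcondition. Determinism makes the existential as strong as a universal, hence the equational
  rules below.\<close>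

definition wp :: "input \<Rightarrow> com \<Rightarrow> (nat \<Rightarrow> state \<Rightarrow> bool) \<Rightarrow> state \<Rightarrow> bool" where
  "wp I c Q s \<longleftrightarrow> (\<exists>t s'. exec I c s t s' \<and> Q t s')"

lemma wp_exec: "exec I c s t s' \<Longrightarrow> wp I c Q s \<longleftrightarrow> Q t s'"
  unfolding wp_def using exec_deterministic by blast

lemma wp_simps [simp]:
  "wp I (Const x k) Q (r, mem) = Q 1 (r(x := k), mem)"
  "wp I (Add x y z) Q (r, mem) = Q 1 (r(x := r y + r z), mem)"
  "wp I (Sub x y z) Q (r, mem) = Q 1 (r(x := r y - r z), mem)"
  "wp I (Load x y) Q (r, mem) = Q 1 (r(x := mem (r y)), mem)"
  "wp I (Store x y) Q (r, mem) = Q 1 (r, mem(r x := r y))"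
  "wp I (Read_Adj x y z) Q (r, mem) = Q 1 (r(x := of_bool (adj_bit I (r y) (r z))), mem)"
  "wp I (Read_Table x y z) Q (r, mem) = Q 1 (r(x := of_bool (table_bit I (r y) (r z))), mem)"
  by (rule wp_exec, rule exec.intros)+

lemma wp_Seq [simp]: "wp I (Seq c1 c2) Q s = wp I c1 (\<lambda>t. wp I c2 (\<lambda>u. Q (t + u))) s"
  unfolding wp_def by (blast elim: exec_SeqE intro: exec.Seq)

lemma wp_If [simp]:
  "wp I (If_Less x y c1 c2) Q (r, mem) =
    (if r x < r y then wp I c1 (\<lambda>t. Q (t + 1)) (r, mem) else wp I c2 (\<lambda>t. Q (t + 1)) (r, mem))"
proof (cases "r x < r y")
  case True
  then have "exec I (If_Less x y c1 c2) (r, mem) t s' \<longleftrightarrow>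
      (\<exists>u. t = u + 1 \<and> exec I c1 (r, mem) u s')" for t s'
    using exec.If_True[of "(r, mem)" x y I c1 _ s'] by (auto elim!: exec_IfE)
  with True show ?thesis by (auto simp: wp_def)
next
  case False
  then have "exec I (If_Less x y c1 c2) (r, mem) t s' \<longleftrightarrow>
      (\<exists>u. t = u + 1 \<and> exec I c2 (r, mem) u s')" for t s'
    using exec.If_False[of "(r, mem)" x y I c2 _ s'] by (auto elim!: exec_IfE)
  with False show ?thesis by (auto simp: wp_def)
qed

text \<open>All loops of the program run a fixed number of rounds; the invariant also sees the number of
  rounds and of steps so far.\<close>

lemma wp_While:
  assumes init: "Inv 0 0 r mem"
    and step: "\<And>i t r mem. i < N \<Longrightarrow> Inv i t r mem \<Longrightarrow>
      r x < r y \<and> wp I c (\<lambda>u (r', mem'). Inv (Suc i) (t + u + 1) r' mem') (r, mem)"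
    and final: "\<And>t r mem. Inv N t r mem \<Longrightarrow> \<not> r x < r y \<and> Q (t + 1) (r, mem)"
  shows "wp I (While_Less x y c) Q (r, mem)"
proof -
  \<comment> \<open>Generalised to a start after \<open>i\<close> rounds and \<open>t\<close> steps,
    by induction on the rounds left. Every evaluated test, also the final failing one, accounts for
    a \<open>+ 1\<close>.\<close>
  have "\<exists>u s'. exec I (While_Less x y c) (r, mem) u s' \<and> Q (t + u) s'"
    if "i \<le> N" "Inv i t r mem" for i t r mem
    using that
  proof (induction "N - i" arbitrary: i t r mem)
    case 0
    then show ?case
      using final[of t r mem] exec.While_False[of "(r, mem)" x y I c] by fastforce
  next
    case (Suc k)
    then have i: "i < N" by simp
    from step[OF i Suc.prems(2)] obtain u r' mem' where u: "r x < r y"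
      "exec I c (r, mem) u (r', mem')" "Inv (Suc i) (t + u + 1) r' mem'"
      unfolding wp_def by auto
    from Suc.hyps(1)[OF _ _ u(3)] Suc.hyps(2) i obtain w s' where
      "exec I (While_Less x y c) (r', mem') w s'" "Q (t + u + 1 + w) s'" by force
    then show ?case
      using exec.While_True[of "(r, mem)" x y I c u "(r', mem')" w s'] u
      by (intro exI[of _ "u + w + 1"] exI[of _ s']) (simp add: add_ac)
  qed
  from this[of 0 0] show ?thesis using init by (simp add: wp_def)
qed

text \<open>There is no skip command, so the fold ends in the last command itself; only nonempty
  lists are meant.\<close>

definition seq :: "com list \<Rightarrow> com" where
  "seq cs = foldr Seq (butlast cs) (last cs)"

lemma wp_seq [simp]:
  "wp I (seq [c]) Q s = wp I c Q s"
  "wp I (seq (c # d # cs)) Q s = wp I c (\<lambda>t. wp I (seq (d # cs)) (\<lambda>u. Q (t + u))) s"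
  by (simp_all add: seq_def)

section \<open>Testing an edge\<close>

text \<open>Registers: 3 holds the constant 1 and 4 the constant 0; 5 and 6 are the endpoints of the current
  edge, 9 counts the edges chosen so far, 10 is the result, 17 records a mismatch, and 7, 8 are
  scratch, so that \<open>Const 8 0\<close> or \<open>Const 7 0\<close> serve as no-ops. The program \<open>table_sizes\<close> puts
  \<open>2 ^ (j + 1)\<close> and \<open>2 ^ (\<delta> + 1)\<close> into 14 and 15, where \<open>\<delta>\<close> is the degree of the player in register
  \<open>x\<close> and the one in register \<open>y\<close> is its neighbour number \<open>j\<close>.\<close>

definition table_sizes :: "nat \<Rightarrow> nat \<Rightarrow> com" where
  "table_sizes x y = seq
    [Const 7 0, Const 14 2, Const 15 2,
     While_Less 7 0 (seq
       [Read_Adj 8 x 7,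
        If_Less 4 8 (Seq (Add 15 15 15) (If_Less 7 y (Add 14 14 14) (Const 8 0))) (Const 8 0),
        Add 7 7 3])]"

text \<open>16 is the index into the table, 12 that index modulo register 14, and 13 the expected entry: it
  flips with bit 0 of the index at every step, and with bit \<open>j + 1\<close> whenever 12 wraps around.\<close>

definition scan_table :: "bool \<Rightarrow> nat \<Rightarrow> com" where
  "scan_table p x = seq
    [Const 12 0, Const 13 (of_bool p), Const 16 0,
     While_Less 16 15 (seq
       [Read_Table 8 x 16,
        If_Less 8 13 (Const 17 1) (Const 7 0),
        If_Less 13 8 (Const 17 1) (Const 8 0),
        Sub 13 3 13,
        Add 16 16 3,
        Add 12 12 3,
        If_Less 12 14 (Const 8 0) (Seq (Const 12 0) (Sub 13 3 13))])]"

definition test_player :: "bool \<Rightarrow> nat \<Rightarrow> nat \<Rightarrow> com" where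
  "test_player p x y = Seq (table_sizes x y) (scan_table p x)"

text \<open>For neighbours this is the number that \<open>encode\<close> gives them. Allowing any
  \<open>v\<close> makes it a prefix count for loops over the vertices, ending in the
  degree.\<close>

definition nbr_index :: "nat set set \<Rightarrow> nat \<Rightarrow> nat \<Rightarrow> nat" where
  "nbr_index E u v = card {w \<in> nbhd E u. w < v}"

lemma nbr_index_0 [simp]: "nbr_index E u 0 = 0"
  by (simp add: nbr_index_def)

lemma nbr_index_Suc: "nbr_index E u (Suc v) = nbr_index E u v + of_bool ({u, v} \<in> E)"
proof -
  have "{w \<in> nbhd E u. w < Suc v} =
      (if {u, v} \<in> E then insert v {w \<in> nbhd E u. w < v} else {w \<in> nbhd E u. w < v})"
    by (auto simp: nbhd_def less_Suc_eq insert_commute)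
  then show ?thesis by (simp add: nbr_index_def)
qed

lemma nbr_index_min_Suc:
  "nbr_index E u (min (Suc i) v) = nbr_index E u (min i v) + of_bool ({u, i} \<in> E \<and> i < v)"
  by (cases "i < v") (simp_all add: nbr_index_Suc min_def)

lemma nbr_index_eq_degree: "nbhd E u \<subseteq> {..<n} \<Longrightarrow> nbr_index E u n = degree E u"
  unfolding nbr_index_def degree_def by (rule arg_cong[of _ _ card]) auto

lemma wp_table_sizes:
  assumes adj: "adj_bit I = (\<lambda>u v. {u, v} \<in> E)" and V: "nbhd E (r x) \<subseteq> {..<n}" "r y \<le> n"
    and r: "r 0 = n" "r 3 = 1" "r 4 = 0" and xy: "(x, y) = (5, 6) \<or> (x, y) = (6, 5)"
    and post: "\<And>t r'. t \<le> 7 * n + 4 \<Longrightarrow> (\<forall>z. z \<notin> {7, 8, 14, 15} \<longrightarrow> r' z = r z) \<Longrightarrow>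
      r' 14 = 2 ^ (nbr_index E (r x) (r y) + 1) \<Longrightarrow> r' 15 = 2 ^ (degree E (r x) + 1) \<Longrightarrow> Q t (r', mem)"
  shows "wp I (table_sizes x y) Q (r, mem)"
proof -
  \<comment> \<open>A round takes at most 7 steps, its test included. Only neighbours below
    \<open>r y\<close> double register 14, hence \<open>min i (r y)\<close>.\<close>
  let ?Inv = "\<lambda>i t r' mem'. t \<le> 7 * i \<and> mem' = mem \<and>
      (\<forall>z. z \<notin> {7, 8, 14, 15} \<longrightarrow> r' z = r z) \<and> r' 7 = i \<and>
      r' 14 = 2 ^ (nbr_index E (r x) (min i (r y)) + 1) \<and> r' 15 = 2 ^ (nbr_index E (r x) i + 1)"
  let ?body = "seq
       [Read_Adj 8 x 7,
        If_Less 4 8 (Seq (Add 15 15 15) (If_Less 7 y (Add 14 14 14) (Const 8 0))) (Const 8 0),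
        Add 7 7 3]"
  have wp: "wp I (While_Less 7 0 ?body) Q (r(7 := 0, 14 := 2, 15 := 2), mem)"
    if "\<And>t r'. ?Inv n t r' mem \<Longrightarrow> Q (t + 1) (r', mem)" for Q
  proof (rule wp_While[where Inv = ?Inv and N = n])
    fix i t r' mem' assume i: "i < n" and Inv: "?Inv i t r' mem'"
    have eqs: "r' 0 = n" "r' 3 = 1" "r' 4 = 0" "r' x = r x" "r' y = r y" "r' 7 = i" "x \<noteq> 7" "x \<noteq> 8"
      "y \<noteq> 7" "y \<noteq> 8" "y \<noteq> 15" "y \<noteq> 14"
      "r' 14 = 2 ^ (nbr_index E (r x) (min i (r y)) + 1)" "r' 15 = 2 ^ (nbr_index E (r x) i + 1)"
      using Inv r xy by auto
    show "r' 7 < r' 0 \<and> wp I ?body (\<lambda>u (r'', mem'). ?Inv (Suc i) (t + u + 1) r'' mem') (r', mem')"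
      using Inv i by (simp add: eqs adj nbr_index_Suc nbr_index_min_Suc del: min_Suc1 min_Suc2)
  qed (use r that in auto)
  have "min n (r y) = r y" using V by simp
  then show ?thesis
    unfolding table_sizes_def wp_seq wp_simps
    by (intro wp post) (simp_all add: nbr_index_eq_degree[OF V(1)])
qed

text \<open>For \<open>P = 2 ^ (j + 1)\<close> the parities of \<open>k\<close> and
  \<open>k div P\<close> are the bits 0 and \<open>j + 1\<close> of \<open>k\<close>, so the
  expected entry tells whether the two strategies agree, up to \<open>p\<close>. A round takes at
  most 12 steps.\<close>

lemma wp_scan_table:
  assumes r: "r 3 = 1" "r 4 = 0" "r 14 = P" "0 < P" and x: "x \<in> {5, 6}"
    and post: "\<And>t r'. t \<le> 12 * r 15 + 4 \<Longrightarrow> (\<forall>z. z \<notin> {7, 8, 12, 13, 16, 17} \<longrightarrow> r' z = r z) \<Longrightarrow>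
      r' 17 = (if \<forall>k<r 15. table_bit I (r x) k \<longleftrightarrow> odd (of_bool p + k + k div P) then r 17 else 1)
      \<Longrightarrow> Q t (r', mem)"
  shows "wp I (scan_table p x) Q (r, mem)"
proof -
  define e where "e = (\<lambda>k. odd (of_bool p + k + k div P))"
  have e_0: "e 0 = p" by (simp add: e_def)
  have mod_cases: "Suc (k mod P) = P \<or> Suc (k mod P) < P" for k
    using mod_less_divisor[OF r(4), of k] by linarith
  \<comment> \<open>Moving to \<open>Suc k\<close> flips the parity of \<open>k\<close>; at a
    wrap-around \<open>k div P\<close> grows by one as well and the two flips cancel.\<close>
  have e_Suc: "e (Suc k) = (if Suc (k mod P) < P then \<not> e k else e k)" for k
    using mod_cases[of k] by (auto simp: e_def div_Suc mod_Suc)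
  have mod_Suc_eq: "Suc k mod P = (if Suc (k mod P) < P then Suc (k mod P) else 0)" for k
    using mod_cases[of k] by (auto simp: mod_Suc)
  define good where "good = (\<lambda>i. \<forall>k<i. table_bit I (r x) k \<longleftrightarrow> e k)"
  have good_Suc: "good (Suc i) \<longleftrightarrow> good i \<and> (table_bit I (r x) i \<longleftrightarrow> e i)" for i
    unfolding good_def by (auto simp: less_Suc_eq)
  let ?Inv = "\<lambda>i t r' mem'. t \<le> 12 * i \<and> mem' = mem \<and>
      (\<forall>z. z \<notin> {7, 8, 12, 13, 16, 17} \<longrightarrow> r' z = r z) \<and> r' 16 = i \<and> r' 12 = i mod P \<and>
      r' 13 = of_bool (e i) \<and> r' 17 = (if good i then r 17 else 1)"
  let ?body = "seq
       [Read_Table 8 x 16,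
        If_Less 8 13 (Const 17 1) (Const 7 0),
        If_Less 13 8 (Const 17 1) (Const 8 0),
        Sub 13 3 13,
        Add 16 16 3,
        Add 12 12 3,
        If_Less 12 14 (Const 8 0) (Seq (Const 12 0) (Sub 13 3 13))]"
  have wp: "wp I (While_Less 16 15 ?body) Q (r(12 := 0, 13 := of_bool p, 16 := 0), mem)"
    if "\<And>t r'. ?Inv (r 15) t r' mem \<Longrightarrow> Q (t + 1) (r', mem)" for Q
  proof (rule wp_While[where Inv = ?Inv and N = "r 15"])
    fix i t r' mem' assume i: "i < r 15" and Inv: "?Inv i t r' mem'"
    have eqs: "r' 3 = 1" "r' 4 = 0" "r' 14 = P" "r' x = r x" "r' 15 = r 15" "x \<noteq> 8" "r' 16 = i"
      "r' 12 = i mod P" "r' 13 = of_bool (e i)" "r' 17 = (if good i then r 17 else 1)"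
      using Inv r x by auto
    show "r' 16 < r' 15 \<and> wp I ?body (\<lambda>u (r'', mem'). ?Inv (Suc i) (t + u + 1) r'' mem') (r', mem')"
      using Inv i by (cases "table_bit I (r x) i"; cases "e i")
        (simp_all add: eqs e_Suc mod_Suc_eq good_Suc)
  next
    show "?Inv 0 0 (r(12 := 0, 13 := of_bool p, 16 := 0)) mem"
      by (auto simp: e_0 good_def)
  qed (use r that in auto)
  show ?thesis
    unfolding scan_table_def wp_seq wp_simps
  proof (rule wp, rule post)
    fix t r' assume Inv: "?Inv (r 15) t r' mem"
    then show "1 + (1 + (1 + (t + 1))) \<le> 12 * r 15 + 4" by linarith
    show "\<forall>z. z \<notin> {7, 8, 12, 13, 16, 17} \<longrightarrow> r' z = r z" using Inv by blast
    show "r' 17 = (if \<forall>k<r 15. table_bit I (r x) k \<longleftrightarrow> odd (of_bool p + k + k div P)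
        then r 17 else 1)"
      using Inv unfolding good_def e_def by blast
  qed
qed

lemma wp_test_player:
  assumes adj: "adj_bit I = (\<lambda>u v. {u, v} \<in> E)" and V: "nbhd E (r x) \<subseteq> {..<n}" "r y \<le> n"
    and r: "r 0 = n" "r 3 = 1" "r 4 = 0" and xy: "(x, y) = (5, 6) \<or> (x, y) = (6, 5)"
    and d: "degree E (r x) \<le> d"
    and post: "\<And>t r'. t \<le> 7 * n + 24 * 2 ^ d + 8 \<Longrightarrow>
      (\<forall>z. z \<notin> {7, 8, 12, 13, 14, 15, 16, 17} \<longrightarrow> r' z = r z) \<Longrightarrow>
      r' 17 = (if \<forall>k<2 ^ (degree E (r x) + 1). table_bit I (r x) k \<longleftrightarrow>
          odd (of_bool p + k + k div 2 ^ (nbr_index E (r x) (r y) + 1)) then r 17 else 1)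
      \<Longrightarrow> Q t (r', mem)"
  shows "wp I (test_player p x y) Q (r, mem)"
  unfolding test_player_def wp_Seq
proof (rule wp_table_sizes[OF adj V r xy], rule wp_scan_table)
  fix t r' u r''
  assume *: "t \<le> 7 * n + 4" "\<forall>z. z \<notin> {7, 8, 14, 15} \<longrightarrow> r' z = r z"
    "r' 14 = 2 ^ (nbr_index E (r x) (r y) + 1)" "r' 15 = 2 ^ (degree E (r x) + 1)"
  show "r' 3 = 1" "r' 4 = 0" "r' 14 = 2 ^ (nbr_index E (r x) (r y) + 1)" "0 < (2::nat) ^ (nbr_index E (r x) (r y) + 1)"
    "x \<in> {5, 6}"
    using * r xy by auto
  have "r' x = r x" using * xy by auto
  have "r' 15 \<le> 2 * 2 ^ d" using * d by simp
  assume "u \<le> 12 * r' 15 + 4" "\<forall>z. z \<notin> {7, 8, 12, 13, 16, 17} \<longrightarrow> r'' z = r' z"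
    "r'' 17 = (if \<forall>k<r' 15. table_bit I (r' x) k \<longleftrightarrow>
      odd (of_bool p + k + k div 2 ^ (nbr_index E (r x) (r y) + 1)) then r' 17 else 1)"
  moreover from this(1) have "t + u \<le> 7 * n + 24 * 2 ^ d + 8"
    using *(1) \<open>r' 15 \<le> 2 * 2 ^ d\<close> by linarith
  ultimately show "Q (t + u) (r'', mem)"
    using * \<open>r' x = r x\<close> by (intro post) auto
qed

section \<open>Table indices as binary codes of a strategy and a profile\<close>

lemma nbr_index_strict_mono:
  assumes "finite (nbhd E u)" "v \<in> nbhd E u" "v < w"
  shows "nbr_index E u v < nbr_index E u w"
  unfolding nbr_index_def using assms by (intro psubset_card_mono) auto

lemma nbr_index_less_degree:
  assumes "finite (nbhd E u)" "v \<in> nbhd E u"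
  shows "nbr_index E u v < degree E u"
  unfolding nbr_index_def degree_def using assms by (intro psubset_card_mono) auto

lemma inj_on_nbr_index: "finite (nbhd E u) \<Longrightarrow> inj_on (nbr_index E u) (nbhd E u)"
  by (rule linorder_inj_onI') (metis nbr_index_strict_mono less_irrefl)

text \<open>The index is a binary number: digit 0 is \<open>s\<close>, digit \<open>j + 1\<close>
  the strategy of neighbour number \<open>j\<close>, recovered from \<open>j\<close> by inverting
  the injective numbering.\<close>

lemma table_index_exists:
  assumes "finite (nbhd E u)"
  obtains k :: nat where "k < 2 ^ (degree E u + 1)" "bit k 0 = s"
    "\<And>w. w \<in> nbhd E u \<Longrightarrow> bit k (nbr_index E u w + 1) = \<tau> w"
proof -
  define bs where "bs = map (\<lambda>j. if j = 0 then s else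
    \<tau> (the_inv_into (nbhd E u) (nbr_index E u) (j - 1))) [0..<degree E u + 1]"
  define k :: nat where "k = horner_sum of_bool 2 bs"
  have k: "bit k j \<longleftrightarrow> j < degree E u + 1 \<and> bs ! j" for j
    by (simp add: k_def bit_horner_sum_bit_iff bs_def del: upt_Suc)
  have "take_bit (degree E u + 1) k = k"
    by (simp add: k_def take_bit_horner_sum_bit_eq bs_def del: upt_Suc)
  then have "k < 2 ^ (degree E u + 1)"
    using take_bit_nat_less_exp[of "degree E u + 1" k] by (simp only:)
  moreover have "bit k 0 = s"
    by (simp add: k bs_def del: upt_Suc bit_0)
  moreover have "bit k (nbr_index E u w + 1) = \<tau> w" if "w \<in> nbhd E u" for w
    using nbr_index_less_degree[OF assms that] that
    by (simp add: k bs_def the_inv_into_f_f[OF inj_on_nbr_index[OF assms]] del: upt_Suc)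
  ultimately show ?thesis by (rule that)
qed

text \<open>Turns a condition on all profiles into a scan of the table: two bits agree iff their sum
  is even, and adding \<open>p\<close> selects agreement or disagreement. The converse needs every
  strategy and profile to have an index in range.\<close>

lemma conforms_iff_table:
  assumes G: "simple_graph {..<n} E" and u: "u < n" and v: "v \<in> nbhd E u"
  shows "conforms E BR u v p \<longleftrightarrow> (\<forall>k<2 ^ (degree E u + 1). table_bit (encode n E BR) u k \<longleftrightarrow>
    odd (of_bool p + k + k div 2 ^ (nbr_index E u v + 1)))"
proof -
  define \<rho> where "\<rho> = (\<lambda>k :: nat. \<lambda>w\<in>nbhd E u. bit k (nbr_index E u w + 1))"
  have tab: "table_bit (encode n E BR) u k \<longleftrightarrow> BR u (bit k 0) (\<rho> k)" if "k < 2 ^ (degree E u + 1)" for k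
    using u that unfolding encode_def \<rho>_def nbr_index_def by (simp only: input.select_convs simp_thms)
  have par: "odd (of_bool p + k + k div 2 ^ (nbr_index E u v + 1)) \<longleftrightarrow> ((bit k 0 = \<rho> k v) = p)" for k
  proof -
    have "odd (of_bool p + k + x) \<longleftrightarrow> ((odd k = odd x) = p)" for x :: nat
      by (cases p) auto
    then show ?thesis
      using v by (simp only: \<rho>_def restrict_apply' bit_iff_odd[of k "_ + 1"] bit_0)
  qed
  show ?thesis
  proof (rule iffI, rule allI, rule impI)
    fix k :: nat assume c: "conforms E BR u v p" and k: "k < 2 ^ (degree E u + 1)"
    have "\<rho> k \<in> nbhd E u \<rightarrow>\<^sub>E UNIV" by (simp add: \<rho>_def)
    then have "BR u (bit k 0) (\<rho> k) \<longleftrightarrow> ((bit k 0 = \<rho> k v) = p)"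
      by (rule c[unfolded conforms_def, THEN spec, THEN bspec])
    then show "table_bit (encode n E BR) u k \<longleftrightarrow>
        odd (of_bool p + k + k div 2 ^ (nbr_index E u v + 1))"
      by (simp only: tab[OF k] par)
  next
    assume *: "\<forall>k<2 ^ (degree E u + 1). table_bit (encode n E BR) u k \<longleftrightarrow>
      odd (of_bool p + k + k div 2 ^ (nbr_index E u v + 1))"
    show "conforms E BR u v p"
      unfolding conforms_def
    proof (intro allI ballI)
      fix s and \<tau> :: "nat \<Rightarrow> bool" assume \<tau>: "\<tau> \<in> nbhd E u \<rightarrow>\<^sub>E UNIV"
      obtain k :: nat where k: "k < 2 ^ (degree E u + 1)" "bit k 0 = s"
        "\<And>w. w \<in> nbhd E u \<Longrightarrow> bit k (nbr_index E u w + 1) = \<tau> w"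
        using table_index_exists[OF finite_nbhd[OF G], of u s \<tau>] by metis
      have "\<rho> k = \<tau>"
        unfolding \<rho>_def using \<tau> k(3) by (intro extensionalityI[of _ "nbhd E u"]) (auto simp: PiE_def)
      then show "BR u s \<tau> \<longleftrightarrow> ((s = \<tau> v) = p)"
        using *[rule_format, OF k(1)] unfolding tab[OF k(1)] par k(2) by simp
    qed
  qed
qed

lemma blocked_doubleton:
  assumes "u \<noteq> v"
  shows "blocked E BR {u, v} \<longleftrightarrow> conforms E BR u v True \<and> conforms E BR v u False \<or>
    conforms E BR u v False \<and> conforms E BR v u True"
  unfolding blocked_def using assms by (auto simp: doubleton_eq_iff)

text \<open>Register 10 is raised but never cleared, so it collects the disjunction over both ways
  and over all tested edges; register 17 is reset for each way.\<close>

definition check :: "bool \<Rightarrow> com" where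
  "check p = seq
    [Const 17 0, test_player p 5 6, test_player (\<not> p) 6 5,
     If_Less 4 17 (Const 8 0) (Const 10 1)]"

text \<open>The two stores withdraw both endpoints from the available vertices; counting the edge in
  register 9 serves the quota \<open>m\<close>.\<close>

definition test_edge :: com where
  "test_edge = seq [Store 5 4, Store 6 4, Add 9 9 3, check True, check False]"

lemma wp_check:
  assumes G: "simple_graph {..<n} E" and I: "I = encode n E BR"
    and r: "r 0 = n" "r 3 = 1" "r 4 = 0" and e: "{r 5, r 6} \<in> bounded_edges E d"
    and post: "\<And>t r'. t \<le> 14 * n + 48 * 2 ^ d + 19 \<Longrightarrow>
      (\<forall>z. z \<notin> {7, 8, 10, 12, 13, 14, 15, 16, 17} \<longrightarrow> r' z = r z) \<Longrightarrow>
      r' 10 = (if conforms E BR (r 5) (r 6) p \<and> conforms E BR (r 6) (r 5) (\<not> p) then 1 else r 10) \<Longrightarrow>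
      Q t (r', mem)"
  shows "wp I (check p) Q (r, mem)"
proof -
  let ?u = "r 5" and ?v = "r 6"
  have eE: "{?u, ?v} \<in> E" and deg: "degree E ?u \<le> d" "degree E ?v \<le> d"
    using e by (auto simp: bounded_edges_def)
  have uv: "?u < n" "?v < n" "?v \<in> nbhd E ?u" "?u \<in> nbhd E ?v"
    using eE G by (auto simp: nbhd_def insert_commute simple_graph_def)
  have adj: "adj_bit I = (\<lambda>u v. {u, v} \<in> E)" by (simp add: I encode_def)
  let ?frame = "\<lambda>r'. \<forall>z. z \<notin> {7, 8, 12, 13, 14, 15, 16, 17} \<longrightarrow> r' z = r z"
  \<comment> \<open>One statement serves both players with \<open>x\<close> and \<open>y\<close>
    swapped: the frame stays relative to the initial \<open>r\<close>, while 17 is carried from the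
    first test to the second.\<close>
  have test: "wp I (test_player p x y) Q (r', mem)"
    if "(x, y) = (5, 6) \<or> (x, y) = (6, 5)" "?frame r'"
      "\<And>t r''. t \<le> 7 * n + 24 * 2 ^ d + 8 \<Longrightarrow> ?frame r'' \<Longrightarrow>
        r'' 17 = (if conforms E BR (r x) (r y) p then r' 17 else 1) \<Longrightarrow> Q t (r'', mem)"
    for p x y Q r'
  proof (rule wp_test_player[where n = n and d = d, OF adj])
    have xy: "r' x = r x" "r' y = r y" using that(1,2) by auto
    have bounds: "r x < n" "r y \<in> nbhd E (r x)" "degree E (r x) \<le> d" "r y \<le> n"
      using that(1) uv deg by auto
    show "nbhd E (r' x) \<subseteq> {..<n}" using nbhd_subset[OF G] .
    show "r' y \<le> n" "degree E (r' x) \<le> d" using bounds xy by simp_all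
    show "r' 0 = n" "r' 3 = 1" "r' 4 = 0" using r that(2) by auto
    fix t r''
    assume *: "t \<le> 7 * n + 24 * 2 ^ d + 8"
      "\<forall>z. z \<notin> {7, 8, 12, 13, 14, 15, 16, 17} \<longrightarrow> r'' z = r' z"
      "r'' 17 = (if \<forall>k<2 ^ (degree E (r' x) + 1). table_bit I (r' x) k \<longleftrightarrow>
          odd (of_bool p + k + k div 2 ^ (nbr_index E (r' x) (r' y) + 1)) then r' 17 else 1)"
    then have "r'' 17 = (if conforms E BR (r x) (r y) p then r' 17 else 1)"
      unfolding xy I conforms_iff_table[OF G bounds(1,2)] by blast
    then show "Q t (r'', mem)"
      using * that(2) by (intro that(3)) auto
  qed (rule that(1))
  show ?thesis
    unfolding check_def wp_seq wp_simps
  proof (rule test, simp, simp, rule test, simp, assumption)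
    fix t r' t' r''
    assume t: "t \<le> 7 * n + 24 * 2 ^ d + 8" "t' \<le> 7 * n + 24 * 2 ^ d + 8"
      and frame: "?frame r'" "?frame r''"
      and r': "r' 17 = (if conforms E BR ?u ?v p then (r(17 := 0)) 17 else 1)"
      and r'': "r'' 17 = (if conforms E BR ?v ?u (\<not> p) then r' 17 else 1)"
    have "r'' 4 = 0" "r'' 10 = r 10" using r frame by auto
    moreover have "0 < r'' 17 \<longleftrightarrow> \<not> (conforms E BR ?u ?v p \<and> conforms E BR ?v ?u (\<not> p))"
      using r' r'' by simp
    ultimately show "wp I (If_Less 4 17 (Const 8 0) (Const 10 1)) (\<lambda>u. Q (1 + (t + (t' + u)))) (r'', mem)"
      using t frame(2) by (auto intro!: post)
  qed
qed

lemma wp_test_edge: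
  assumes G: "simple_graph {..<n} E" and I: "I = encode n E BR"
    and r: "r 0 = n" "r 3 = 1" "r 4 = 0" and e: "{r 5, r 6} \<in> bounded_edges E d"
    and post: "\<And>t r'. t \<le> 28 * n + 96 * 2 ^ d + 41 \<Longrightarrow>
      (\<forall>z. z \<notin> {7, 8, 9, 10, 12, 13, 14, 15, 16, 17} \<longrightarrow> r' z = r z) \<Longrightarrow> r' 9 = Suc (r 9) \<Longrightarrow>
      r' 10 = (if blocked E BR {r 5, r 6} then 1 else r 10) \<Longrightarrow>
      Q t (r', mem(r 5 := 0, r 6 := 0))"
  shows "wp I test_edge Q (r, mem)"
proof -
  have "card {r 5, r 6} = 2" using e G by (auto simp: simple_graph_def bounded_edges_def)
  then have ne: "r 5 \<noteq> r 6" by auto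
  show ?thesis
    unfolding test_edge_def wp_seq wp_simps
  proof (rule wp_check[OF G I])
    fix t r'
    assume *: "t \<le> 14 * n + 48 * 2 ^ d + 19"
      "\<forall>z. z \<notin> {7, 8, 10, 12, 13, 14, 15, 16, 17} \<longrightarrow> r' z = (r(9 := r 9 + r 3)) z"
      "r' 10 = (if conforms E BR ((r(9 := r 9 + r 3)) 5) ((r(9 := r 9 + r 3)) 6) True \<and>
        conforms E BR ((r(9 := r 9 + r 3)) 6) ((r(9 := r 9 + r 3)) 5) (\<not> True)
        then 1 else (r(9 := r 9 + r 3)) 10)"
    show "wp I (check False) (\<lambda>u. Q (1 + (1 + (1 + (t + u))))) (r', mem(r 5 := r 4, r 6 := r 4))"
    proof (rule wp_check[OF G I])
      show "r' 0 = n" "r' 3 = 1" "r' 4 = 0" "{r' 5, r' 6} \<in> bounded_edges E d"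
        using * r e by auto
      fix t' r''
      assume "t' \<le> 14 * n + 48 * 2 ^ d + 19"
        "\<forall>z. z \<notin> {7, 8, 10, 12, 13, 14, 15, 16, 17} \<longrightarrow> r'' z = r' z"
        "r'' 10 = (if conforms E BR (r' 5) (r' 6) False \<and> conforms E BR (r' 6) (r' 5) (\<not> False)
          then 1 else r' 10)"
      then show "Q (1 + (1 + (1 + (t + t')))) (r'', mem(r 5 := r 4, r 6 := r 4))"
        using * r by (simp add: post blocked_doubleton[OF ne])
    qed
  qed (use r e in simp_all)
qed

section \<open>The greedy search\<close>

text \<open>Memory cell \<open>u\<close> is 1 iff vertex \<open>u\<close> has degree at most \<open>d\<close> and is not matched yet.\<close>

definition mark_available :: com where
  "mark_available = seq
    [Const 5 0,
     While_Less 5 0 (seq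
       [Const 7 0, Const 11 0,
        While_Less 7 0 (seq [Read_Adj 8 5 7, Add 11 11 8, Add 7 7 3]),
        If_Less 2 11 (Const 8 0) (Store 5 3),
        Add 5 5 3])]"

text \<open>Degrees are not part of the input, so they are counted from the adjacency matrix; a
  round of the outer loop takes at most \<open>4 * n + 7\<close> steps.\<close>

lemma wp_mark_available:
  assumes G: "simple_graph {..<n} E" and adj: "adj_bit I = (\<lambda>u v. {u, v} \<in> E)"
    and r: "r 0 = n" "r 2 = d" "r 3 = 1"
    and post: "\<And>t r'. t \<le> n * (4 * n + 7) + 2 \<Longrightarrow> (\<forall>z. z \<notin> {5, 7, 8, 11} \<longrightarrow> r' z = r z) \<Longrightarrow>
      Q t (r', \<lambda>u. of_bool (u < n \<and> degree E u \<le> d))"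
  shows "wp I mark_available Q (r, \<lambda>_. 0)"
proof -
  have count: "wp I (While_Less 7 0 (seq [Read_Adj 8 5 7, Add 11 11 8, Add 7 7 3])) Q
      (r(7 := 0, 11 := 0), mem)"
    if "r 0 = n" "r 3 = 1"
      "\<And>t r'. t \<le> 4 * n + 1 \<Longrightarrow> (\<forall>z. z \<notin> {7, 8, 11} \<longrightarrow> r' z = r z) \<Longrightarrow>
        r' 11 = degree E (r 5) \<Longrightarrow> Q t (r', mem)"
    for r mem Q
  proof (rule wp_While[where N = n and Inv = "\<lambda>i t r' mem'. t \<le> 4 * i \<and> mem' = mem \<and>
      (\<forall>z. z \<notin> {7, 8, 11} \<longrightarrow> r' z = r z) \<and> r' 7 = i \<and> r' 11 = nbr_index E (r 5) i"], goal_cases)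
    case (2 i t r' mem')
    have "r' 0 = n" "r' 3 = 1" "r' 5 = r 5" using 2(2) that by auto
    with 2 show ?case by (simp add: adj nbr_index_Suc)
  next
    case (3 t r' mem')
    have "r' 0 = n" using 3 that by auto
    moreover have "nbr_index E (r 5) n = degree E (r 5)"
      by (rule nbr_index_eq_degree[OF nbhd_subset[OF G]])
    ultimately show ?case using 3 by (auto intro!: that(3))
  qed auto
  let ?mem = "\<lambda>i u. of_bool (u < i \<and> degree E u \<le> d) :: nat"
  have mem_Suc: "?mem (Suc i) = (if degree E i \<le> d then (?mem i)(i := 1) else ?mem i)" for i
    by (auto simp: fun_eq_iff less_Suc_eq)
  show ?thesis
    unfolding mark_available_def wp_seq wp_simps
  proof (rule wp_While[where N = n and Inv = "\<lambda>i t r' mem'. t \<le> i * (4 * n + 7) \<and> mem' = ?mem i \<and>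
      (\<forall>z. z \<notin> {5, 7, 8, 11} \<longrightarrow> r' z = r z) \<and> r' 5 = i"], goal_cases)
    case (2 i t r' mem')
    have *: "r' 0 = n" "r' 2 = d" "r' 3 = 1" "r' 5 = i" "mem' = ?mem i" "t \<le> i * (4 * n + 7)"
      "\<forall>z. z \<notin> {5, 7, 8, 11} \<longrightarrow> r' z = r z" using 2(2) r by auto
    show ?case
      unfolding wp_seq wp_simps
    proof (intro conjI count)
      show "r' 5 < r' 0" using 2 * by simp
      fix t' r''
      assume **: "t' \<le> 4 * n + 1" "\<forall>z. z \<notin> {7, 8, 11} \<longrightarrow> r'' z = r' z" "r'' 11 = degree E (r' 5)"
      have eqs: "r'' 2 = d" "r'' 5 = i" "r'' 3 = 1" "r'' 11 = degree E i" using * ** by auto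
      show "wp I (If_Less 2 11 (Const 8 0) (Store 5 3)) (\<lambda>ta. wp I (Add 5 5 3) (\<lambda>u. case_prod
        (\<lambda>r' mem'. t + (1 + (1 + (t' + (ta + u)))) + 1 \<le> Suc i * (4 * n + 7) \<and> mem' = ?mem (Suc i) \<and>
          (\<forall>z. z \<notin> {5, 7, 8, 11} \<longrightarrow> r' z = r z) \<and> r' 5 = Suc i))) (r'', mem')"
        using * ** unfolding wp_If wp_simps mem_Suc by (simp add: eqs)
    qed (use * in auto)
  next
    case (3 t r' mem')
    have "Q (1 + (t + 1)) (r', ?mem n)" by (rule post) (use 3 in auto)
    moreover have "r' 0 = n" using 3 r by auto
    ultimately show ?case using 3 by simp
  qed (auto simp: fun_eq_iff)
qed

text \<open>Register 8 adds the adjacency bit and the availability bit, so comparing it with the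
  constant 1 tests their conjunction; \<open>Add 6 7 4\<close> copies register 7, since 4 holds
  0.\<close>

definition find_partner :: com where
  "find_partner = seq
    [Const 7 0, Const 11 0,
     While_Less 7 0 (seq
       [Read_Adj 8 5 7, Load 12 7, Add 8 8 12,
        If_Less 3 8 (Seq (Const 11 1) (Add 6 7 4)) (Const 8 0),
        Add 7 7 3])]"

lemma wp_find_partner:
  assumes adj: "adj_bit I = (\<lambda>u v. {u, v} \<in> E)" and A: "A \<subseteq> {..<n}"
    and r: "r 0 = n" "r 3 = 1" "r 4 = 0" "r 5 = u" and mem: "mem = (\<lambda>w. of_bool (w \<in> A))"
    and post: "\<And>t r'. t \<le> 8 * n + 3 \<Longrightarrow> (\<forall>z. z \<notin> {6, 7, 8, 11, 12} \<longrightarrow> r' z = r z) \<Longrightarrow>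
      r' 11 = of_bool ({v \<in> A. {u, v} \<in> E} \<noteq> {}) \<Longrightarrow>
      ({v \<in> A. {u, v} \<in> E} \<noteq> {} \<Longrightarrow> r' 6 = Max {v \<in> A. {u, v} \<in> E}) \<Longrightarrow> Q t (r', mem)"
  shows "wp I find_partner Q (r, mem)"
proof -
  define B where "B = (\<lambda>i. {v \<in> A. v < i \<and> {u, v} \<in> E})"
  have B_Suc: "B (Suc i) = (if i \<in> A \<and> {u, i} \<in> E then insert i (B i) else B i)" for i
    by (auto simp: B_def less_Suc_eq)
  have Max_Suc: "Max (insert i (B i)) = i" for i
    by (rule Max_eqI) (auto simp: B_def)
  have B_n: "B n = {v \<in> A. {u, v} \<in> E}" using A by (auto simp: B_def)
  show ?thesis
    unfolding find_partner_def wp_seq wp_simps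
  proof (rule wp_While[where N = n and Inv = "\<lambda>i t r' mem'. t \<le> 8 * i \<and> mem' = mem \<and>
      (\<forall>z. z \<notin> {6, 7, 8, 11, 12} \<longrightarrow> r' z = r z) \<and> r' 7 = i \<and> r' 11 = of_bool (B i \<noteq> {}) \<and>
      (B i \<noteq> {} \<longrightarrow> r' 6 = Max (B i))"], goal_cases)
    case (2 i t r' mem')
    have "r' 0 = n" "r' 3 = 1" "r' 4 = 0" "r' 5 = u" "mem' = mem" "r' 7 = i" using 2(2) r by auto
    with 2 show ?case
      by (cases "i \<in> A"; cases "{u, i} \<in> E") (simp_all add: adj B_Suc Max_Suc mem)
  next
    case (3 t r' mem')
    have "r' 0 = n" using 3 r by auto
    with 3 show ?case unfolding B_n by (auto intro!: post)
  qed (auto simp: B_def)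
qed

text \<open>The matching as a function of the graph only, so that it is fixed before the game is drawn. The
  loop in \<open>find_partner\<close> retains the last candidate, hence the maximum.\<close>

primrec greedy :: "nat set set \<Rightarrow> nat \<Rightarrow> nat \<Rightarrow> nat \<Rightarrow> nat \<Rightarrow> nat set \<times> nat set set" where
  "greedy E d m n 0 = ({u. u < n \<and> degree E u \<le> d}, {})"
| "greedy E d m n (Suc u) =
    (let (A, M) = greedy E d m n u; B = {v \<in> A. {u, v} \<in> E}
     in if card M < m \<and> u \<in> A \<and> B \<noteq> {} then (A - {u, Max B}, insert {u, Max B} M) else (A, M))"

lemma greedy_Suc:
  assumes "greedy E d m n u = (A, M)" and B: "B = {v \<in> A. {u, v} \<in> E}"
  shows "greedy E d m n (Suc u) = (if card M < m \<and> u \<in> A \<and> B \<noteq> {}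
    then (A - {u, Max B}, insert {u, Max B} M) else (A, M))"
  by (simp only: assms greedy.simps Let_def prod.case)

text \<open>Available and matched vertices partition those of degree at most \<open>d\<close>. The
  last clause is maximality among processed vertices; it persists because \<open>A\<close> only
  shrinks, and is suspended once the quota \<open>m\<close> is reached.\<close>

definition greedy_inv :: "nat set set \<Rightarrow> nat \<Rightarrow> nat \<Rightarrow> nat \<Rightarrow> nat \<Rightarrow> nat set \<Rightarrow> nat set set \<Rightarrow> bool" where
  "greedy_inv E d m n i A M \<longleftrightarrow>
    A \<union> \<Union>M = {u. u < n \<and> degree E u \<le> d} \<and> A \<inter> \<Union>M = {} \<and>
    M \<subseteq> bounded_edges E d \<and> pairwise disjnt M \<and> card M \<le> m \<and>
    (card M < m \<longrightarrow> (\<forall>u\<in>A. \<forall>v\<in>A. u < i \<longrightarrow> {u, v} \<notin> E))"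

text \<open>The first two conclusions also serve the analysis of the program: both tables are short,
  and the counter follows \<open>card M\<close>.\<close>

lemma greedy_step:
  assumes G: "simple_graph {..<n} E" and inv: "greedy_inv E d m n i A M"
    and m: "card M < m" and uv: "u \<in> A" "v \<in> A" "{u, v} \<in> E"
  shows "{u, v} \<in> bounded_edges E d" "card (insert {u, v} M) = Suc (card M)" "u = i \<Longrightarrow>
    greedy_inv E d m n (Suc i) (A - {u, v}) (insert {u, v} M)"
proof -
  have sub: "A \<subseteq> {u. u < n \<and> degree E u \<le> d}" and disj: "A \<inter> \<Union>M = {}"
    and ME: "M \<subseteq> bounded_edges E d"
    using inv unfolding greedy_inv_def by blast+
  show e: "{u, v} \<in> bounded_edges E d"
    using sub uv by (auto simp: bounded_edges_def)
  have "{u, v} \<notin> M" using disj uv by blast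
  moreover have "finite M"
    by (rule finite_subset[of M E])
      (use ME simple_graph_finite_edges[OF G] in \<open>auto simp: bounded_edges_def\<close>)
  ultimately show card: "card (insert {u, v} M) = Suc (card M)" by simp
  assume "u = i"
  show "greedy_inv E d m n (Suc i) (A - {u, v}) (insert {u, v} M)"
    unfolding greedy_inv_def
  proof (intro conjI)
    have "A - {u, v} \<union> \<Union>(insert {u, v} M) = A \<union> \<Union>M" using uv by blast
    then show "A - {u, v} \<union> \<Union>(insert {u, v} M) = {u. u < n \<and> degree E u \<le> d}"
      using inv by (simp add: greedy_inv_def)
    show "(A - {u, v}) \<inter> \<Union>(insert {u, v} M) = {}" using disj by blast
    show "insert {u, v} M \<subseteq> bounded_edges E d" using e ME by simp
    have "disjnt {u, v} f \<and> disjnt f {u, v}" if "f \<in> M" for f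
      using disj uv that by (auto simp: disjnt_def)
    moreover have "pairwise disjnt M" using inv by (simp add: greedy_inv_def)
    ultimately show "pairwise disjnt (insert {u, v} M)"
      unfolding pairwise_insert by blast
    show "card (insert {u, v} M) \<le> m" using card m by simp
    show "card (insert {u, v} M) < m \<longrightarrow>
        (\<forall>u'\<in>A - {u, v}. \<forall>v'\<in>A - {u, v}. u' < Suc i \<longrightarrow> {u', v'} \<notin> E)"
      using inv m \<open>u = i\<close> unfolding greedy_inv_def less_Suc_eq by blast
  qed
qed

lemma greedy_inv_greedy:
  assumes G: "simple_graph {..<n} E" and "greedy E d m n i = (A, M)"
  shows "greedy_inv E d m n i A M"
  using assms(2)
proof (induction i arbitrary: A M)
  case 0
  then show ?case by (auto simp: greedy_inv_def)
next
  case (Suc i)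
  obtain A' M' where AM: "greedy E d m n i = (A', M')" by fastforce
  note inv = Suc.IH[OF AM]
  define B where "B = {v \<in> A'. {i, v} \<in> E}"
  show ?case
  proof (cases "card M' < m \<and> i \<in> A' \<and> B \<noteq> {}")
    case True
    have "finite A'"
      by (rule finite_subset[of _ "{..<n}"]) (use inv in \<open>auto simp: greedy_inv_def\<close>)
    then have "Max B \<in> B" using True by (intro Max_in) (auto simp: B_def)
    then have "greedy_inv E d m n (Suc i) (A' - {i, Max B}) (insert {i, Max B} M')"
      using True by (intro greedy_step(3)[OF G inv]) (auto simp: B_def)
    moreover have "A = A' - {i, Max B}" "M = insert {i, Max B} M'"
      using Suc.prems True unfolding greedy_Suc[OF AM B_def] by (simp_all only: if_True simp_thms prod.inject)
    ultimately show ?thesis by simp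
  next
    case False
    then have "A = A'" "M = M'"
      using Suc.prems False unfolding greedy_Suc[OF AM B_def] by (simp_all only: if_False simp_thms prod.inject)
    then show ?thesis
      using inv False unfolding greedy_inv_def B_def less_Suc_eq by blast
  qed
qed

text \<open>After all rounds the invariant leaves no edge inside \<open>A\<close>, unless
  \<open>m\<close> edges were found; a bounded edge missing \<open>\<Union>M\<close> would have both
  endpoints in \<open>A\<close>.\<close>

lemma greedy_matching:
  assumes G: "simple_graph {..<n} E" and "greedy E d m n n = (A, M)"
  shows "independent_edges E M" "M \<subseteq> bounded_edges E d" "m \<le> card M \<or> maximal_matching E d M"
proof -
  have inv: "A \<union> \<Union>M = {u. u < n \<and> degree E u \<le> d}" "M \<subseteq> bounded_edges E d" "pairwise disjnt M"
    "card M < m \<Longrightarrow> u \<in> A \<Longrightarrow> v \<in> A \<Longrightarrow> u < n \<Longrightarrow> {u, v} \<notin> E" for u v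
    using greedy_inv_greedy[OF assms] unfolding greedy_inv_def by blast+
  show M: "M \<subseteq> bounded_edges E d" by (rule inv)
  then show ind: "independent_edges E M"
    using inv(3) by (auto simp: independent_edges_def bounded_edges_def)
  have "e \<inter> \<Union>M \<noteq> {}" if m: "card M < m" and e: "e \<in> bounded_edges E d" for e
  proof
    assume *: "e \<inter> \<Union>M = {}"
    have "e \<in> E" using e by (simp add: bounded_edges_def)
    then obtain u v where uv: "e = {u, v}" "u \<noteq> v" "u \<in> {..<n}" "v \<in> {..<n}" "v \<in> nbhd E u" "u \<in> nbhd E v"
      by (rule simple_graph_edgeE[OF G])
    then have "{u, v} \<subseteq> A \<union> \<Union>M"
      unfolding inv(1) using e by (auto simp: bounded_edges_def)
    then have "u \<in> A" "v \<in> A" using * uv(1) by blast+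
    then show False using inv(4)[OF m] uv \<open>e \<in> E\<close> by auto
  qed
  then show "m \<le> card M \<or> maximal_matching E d M"
    using ind M unfolding maximal_matching_def by (meson not_le)
qed

definition search_step :: com where
  "search_step = seq
    [Load 8 5,
     If_Less 9 1 (If_Less 4 8 (Seq find_partner (If_Less 4 11 test_edge (Const 8 0))) (Const 8 0))
       (Const 8 0)]"

definition search :: com where
  "search = seq [Const 5 0, While_Less 5 0 (seq [search_step, Add 5 5 3])]"

text \<open>The cost of reading tables is charged to the growth of the matching, so over all rounds
  it telescopes to at most \<open>m\<close> times \<open>96 * 2 ^ d\<close>; the rest of a round is
  linear in \<open>n\<close>.\<close>

lemma wp_search_step:
  assumes G: "simple_graph {..<n} E" and I: "I = encode n E BR"
    and r: "r 0 = n" "r 1 = m" "r 3 = 1" "r 4 = 0" "r 5 = i" "r 9 = card M"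
      "r 10 = of_bool (\<exists>e\<in>M. blocked E BR e)"
    and AM: "greedy E d m n i = (A, M)" "greedy E d m n (Suc i) = (A', M')"
    and mem: "mem = (\<lambda>w. of_bool (w \<in> A))"
    and post: "\<And>t r'. t \<le> 36 * n + 50 + (card M' - card M) * (96 * 2 ^ d) \<Longrightarrow> card M \<le> card M' \<Longrightarrow>
      r' 0 = n \<Longrightarrow> r' 1 = m \<Longrightarrow> r' 3 = 1 \<Longrightarrow> r' 4 = 0 \<Longrightarrow> r' 5 = i \<Longrightarrow> r' 9 = card M' \<Longrightarrow>
      r' 10 = of_bool (\<exists>e\<in>M'. blocked E BR e) \<Longrightarrow> Q t (r', \<lambda>w. of_bool (w \<in> A'))"
  shows "wp I search_step Q (r, mem)"
proof -
  define B where "B = {v \<in> A. {i, v} \<in> E}"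
  have inv: "greedy_inv E d m n i A M" by (rule greedy_inv_greedy[OF G AM(1)])
  have A: "A \<subseteq> {..<n}" using inv by (auto simp: greedy_inv_def)
  have AM': "(A', M') = (if card M < m \<and> i \<in> A \<and> B \<noteq> {} then (A - {i, Max B}, insert {i, Max B} M) else (A, M))"
    using AM(2) unfolding greedy_Suc[OF AM(1) B_def] by (rule sym)
  have skip: "Q t (r', mem)"
    if "\<not> (card M < m \<and> i \<in> A \<and> B \<noteq> {})" "t \<le> 36 * n + 50" "\<forall>z. z \<notin> {6, 7, 8, 11, 12} \<longrightarrow> r' z = r z"
    for t r'
  proof -
    have "A' = A" "M' = M" using AM' that(1) by auto
    then show ?thesis
      using post[of t r'] that(2,3) r mem by simp
  qed
  have adj: "adj_bit I = (\<lambda>u v. {u, v} \<in> E)" by (simp add: I encode_def)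
  have mem_i: "mem i = of_bool (i \<in> A)" by (simp add: mem)
  show ?thesis
  proof (cases "card M < m \<and> i \<in> A")
    case False
    then have "Q t (r(8 := x), mem)" if "t \<le> 36 * n + 50" for t x
      by (intro skip) (use that in auto)
    with False show ?thesis by (simp add: r[simplified] search_step_def mem_i)
  next
    case True
    have "wp I find_partner (\<lambda>t. wp I (If_Less 4 11 test_edge (Const 8 0)) (\<lambda>u. Q (Suc (Suc (Suc (t + u))))))
      (r(8 := 1), mem)"
    proof (rule wp_find_partner[OF adj A])
      fix t r'
      assume t: "t \<le> 8 * n + 3" and frame: "\<forall>z. z \<notin> {6, 7, 8, 11, 12} \<longrightarrow> r' z = (r(8 := 1)) z"
        and B: "r' 11 = of_bool ({v \<in> A. {i, v} \<in> E} \<noteq> {})"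
          "{v \<in> A. {i, v} \<in> E} \<noteq> {} \<Longrightarrow> r' 6 = Max {v \<in> A. {i, v} \<in> E}"
      note B = B[folded B_def]
      have regs: "r' 0 = n" "r' 1 = m" "r' 3 = 1" "r' 4 = 0" "r' 5 = i" "r' 9 = card M"
        "r' 10 = of_bool (\<exists>e\<in>M. blocked E BR e)"
        using r frame by auto
      show "wp I (If_Less 4 11 test_edge (Const 8 0)) (\<lambda>u. Q (Suc (Suc (Suc (t + u))))) (r', mem)"
      proof (cases "B = {}")
        case True
        then show ?thesis
          using regs B t frame by (auto intro!: skip)
      next
        case False
        have "finite A" using A finite_subset by blast
        then have "Max B \<in> B" using False by (intro Max_in) (auto simp: B_def)
        then have v: "Max B \<in> A" "{i, Max B} \<in> E" by (auto simp: B_def)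
        note step = greedy_step(1,2)[OF G inv True[THEN conjunct1] True[THEN conjunct2] v]
        have AM'': "A' = A - {i, Max B}" "M' = insert {i, Max B} M"
          using AM' True False by auto
        have eqs: "r' 5 = i" "r' 6 = Max B" using regs B(2) False by auto
        have "wp I test_edge (\<lambda>u. Q (Suc (Suc (Suc (t + (u + 1)))))) (r', mem)"
        proof (rule wp_test_edge[OF G I, of r' d])
          show "r' 0 = n" "r' 3 = 1" "r' 4 = 0" "{r' 5, r' 6} \<in> bounded_edges E d"
            using regs step eqs by auto
          fix t' r''
          assume *: "t' \<le> 28 * n + 96 * 2 ^ d + 41"
            "\<forall>z. z \<notin> {7, 8, 9, 10, 12, 13, 14, 15, 16, 17} \<longrightarrow> r'' z = r' z"
            "r'' 9 = Suc (r' 9)" "r'' 10 = (if blocked E BR {r' 5, r' 6} then 1 else r' 10)"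
          have "mem(r' 5 := 0, r' 6 := 0) = (\<lambda>w. of_bool (w \<in> A'))"
            using eqs by (auto simp: AM'' mem fun_eq_iff)
          moreover have "Q (Suc (Suc (Suc (t + (t' + 1))))) (r'', \<lambda>w. of_bool (w \<in> A'))"
          proof (rule post)
            show "Suc (Suc (Suc (t + (t' + 1)))) \<le> 36 * n + 50 + (card M' - card M) * (96 * 2 ^ d)"
              using t * step(2) by (simp add: AM'')
            show "r'' 10 = of_bool (\<exists>e\<in>M'. blocked E BR e)"
              using *(4) regs(7) eqs by (auto simp: AM'')
          qed (use * regs step(2) AM'' in auto)
          ultimately show "Q (Suc (Suc (Suc (t + (t' + 1))))) (r'', mem(r' 5 := 0, r' 6 := 0))" by simp
        qed
        then show ?thesis using regs B False by simp
      qed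
    qed (use r mem in auto)
    then show ?thesis using True by (simp add: r[simplified] mem_i search_step_def)
  qed
qed

lemma wp_search:
  assumes G: "simple_graph {..<n} E" and I: "I = encode n E BR"
    and r: "r 0 = n" "r 1 = m" "r 3 = 1" "r 4 = 0" "r 9 = 0" "r 10 = 0"
    and greedy: "greedy E d m n n = (A, M)"
    and post: "\<And>t r' mem'. t \<le> n * (36 * n + 60) + m * (96 * 2 ^ d) + 2 \<Longrightarrow>
      r' 4 = 0 \<Longrightarrow> r' 10 = of_bool (\<exists>e\<in>M. blocked E BR e) \<Longrightarrow> Q t (r', mem')"
  shows "wp I search Q (r, \<lambda>u. of_bool (u < n \<and> degree E u \<le> d))"
  unfolding search_def wp_seq wp_simps
proof (rule wp_While[where N = n and Inv = "\<lambda>i t r' mem'. \<exists>A M. greedy E d m n i = (A, M) \<and>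
    mem' = (\<lambda>w. of_bool (w \<in> A)) \<and> r' 0 = n \<and> r' 1 = m \<and> r' 3 = 1 \<and> r' 4 = 0 \<and> r' 5 = i \<and>
    r' 9 = card M \<and> r' 10 = of_bool (\<exists>e\<in>M. blocked E BR e) \<and>
    t \<le> i * (36 * n + 60) + card M * (96 * 2 ^ d)"], goal_cases)
  case 1
  show ?case using r by (simp add: fun_eq_iff)
next
  case (2 i t r' mem')
  then obtain A M where *: "greedy E d m n i = (A, M)" "mem' = (\<lambda>w. of_bool (w \<in> A))"
    "r' 0 = n" "r' 1 = m" "r' 3 = 1" "r' 4 = 0" "r' 5 = i" "r' 9 = card M"
    "r' 10 = of_bool (\<exists>e\<in>M. blocked E BR e)" "t \<le> i * (36 * n + 60) + card M * (96 * 2 ^ d)"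
    by blast
  obtain A' M' where AM': "greedy E d m n (Suc i) = (A', M')" by fastforce
  let ?Q = "\<lambda>u (r'', mem''). \<exists>A M. greedy E d m n (Suc i) = (A, M) \<and>
    mem'' = (\<lambda>w. of_bool (w \<in> A)) \<and> r'' 0 = n \<and> r'' 1 = m \<and> r'' 3 = 1 \<and> r'' 4 = 0 \<and> r'' 5 = Suc i \<and>
    r'' 9 = card M \<and> r'' 10 = of_bool (\<exists>e\<in>M. blocked E BR e) \<and>
    t + u + 1 \<le> Suc i * (36 * n + 60) + card M * (96 * 2 ^ d)"
  have "wp I search_step (\<lambda>u. wp I (Add 5 5 3) (\<lambda>v. ?Q (u + v))) (r', mem')"
  proof (rule wp_search_step[OF G I *(3-9) *(1) AM' *(2)])
    fix u and r'' :: "nat \<Rightarrow> nat"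
    assume **: "u \<le> 36 * n + 50 + (card M' - card M) * (96 * 2 ^ d)" "card M \<le> card M'"
      "r'' 0 = n" "r'' 1 = m" "r'' 3 = 1" "r'' 4 = 0" "r'' 5 = i" "r'' 9 = card M'"
      "r'' 10 = of_bool (\<exists>e\<in>M'. blocked E BR e)"
    have "card M * (96 * 2 ^ d) + (card M' - card M) * (96 * 2 ^ d) = card M' * (96 * 2 ^ d)"
      using **(2) by (simp flip: add_mult_distrib)
    then have "t + (u + 1) + 1 \<le> Suc i * (36 * n + 60) + card M' * (96 * 2 ^ d)"
      using *(10) **(1) by simp
    then show "wp I (Add 5 5 3) (\<lambda>v. ?Q (u + v)) (r'', \<lambda>w. of_bool (w \<in> A'))"
      using ** AM' by (simp del: greedy.simps)
  qed
  then have "wp I (seq [search_step, Add 5 5 3]) ?Q (r', mem')" unfolding wp_seq .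
  with * 2(1) show ?case by simp
next
  case (3 t r' mem')
  then have *: "r' 0 = n" "r' 4 = 0" "r' 5 = n" "r' 10 = of_bool (\<exists>e\<in>M. blocked E BR e)"
    "t \<le> n * (36 * n + 60) + card M * (96 * 2 ^ d)"
    using greedy by auto
  have "card M \<le> m"
    using greedy_inv_greedy[OF G greedy] by (simp add: greedy_inv_def)
  then have "card M * (96 * 2 ^ d) \<le> m * (96 * 2 ^ d)" by (rule mult_le_mono1)
  with *(5) have "1 + (t + 1) \<le> n * (36 * n + 60) + m * (96 * 2 ^ d) + 2" by linarith
  then have "Q (1 + (t + 1)) (r', mem')"
    using *(2,4) by (rule post)
  then show ?case using *(1,3) by simp
qed

text \<open>The final addition copies the result to register 0, as register 4 is never written and
  still holds 0.\<close>

definition program :: com where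
  "program = seq [Const 3 1, mark_available, search, Add 0 10 4]"

lemma exec_program:
  assumes G: "simple_graph {..<n} E" and m: "1 \<le> m" and greedy: "greedy E d m n n = (A, M)"
  obtains t s where "exec (encode n E BR) program (init_state n m d) t s"
    "t \<le> 107 * (n ^ 2 + m * 2 ^ (d + 2))" "fst s 0 \<noteq> 0 \<longleftrightarrow> (\<exists>e\<in>M. blocked E BR e)"
proof -
  have "wp (encode n E BR) program (\<lambda>t s. t \<le> n * (4 * n + 7) + n * (36 * n + 60) + m * (96 * 2 ^ d) + 6 \<and>
      (fst s 0 \<noteq> 0 \<longleftrightarrow> (\<exists>e\<in>M. blocked E BR e))) (init_state n m d)"
    unfolding program_def wp_seq init_state_def wp_simps
  proof (rule wp_mark_available[OF G, of _ _ d])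
    fix t and r' :: "nat \<Rightarrow> nat" assume *: "t \<le> n * (4 * n + 7) + 2" "\<forall>z. z \<notin> {5, 7, 8, 11} \<longrightarrow>
      r' z = ((\<lambda>_. 0)(0 := n, 1 := m, 2 := d, 3 := 1)) z"
    show "wp (encode n E BR) search (\<lambda>ta. wp (encode n E BR) (Add 0 10 4)
      (\<lambda>u s. 1 + (t + (ta + u)) \<le> n * (4 * n + 7) + n * (36 * n + 60) + m * (96 * 2 ^ d) + 6 \<and>
        (fst s 0 \<noteq> 0 \<longleftrightarrow> (\<exists>e\<in>M. blocked E BR e))))
      (r', \<lambda>u. of_bool (u < n \<and> degree E u \<le> d))"
      by (rule wp_search[OF G refl _ _ _ _ _ _ greedy]) (use * in auto)
  qed (auto simp: encode_def)
  then obtain t s where *: "exec (encode n E BR) program (init_state n m d) t s"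
    "t \<le> n * (4 * n + 7) + n * (36 * n + 60) + m * (96 * 2 ^ d) + 6"
    "fst s 0 \<noteq> 0 \<longleftrightarrow> (\<exists>e\<in>M. blocked E BR e)"
    unfolding wp_def by blast
  \<comment> \<open>The constant is 107 = 40 + 67, from \<open>40 * n ^ 2 + 67 * n\<close> and
    \<open>n \<le> n ^ 2\<close>; the additive 6 is absorbed through
    \<open>1 \<le> m * 2 ^ d\<close>.\<close>
  have "n \<le> n ^ 2" by (simp add: power2_eq_square)
  moreover have "1 \<le> m * 2 ^ d" using m by simp
  moreover have "n * (4 * n + 7) + n * (36 * n + 60) + m * (96 * 2 ^ d) + 6 = 40 * n ^ 2 + 67 * n + 96 * (m * 2 ^ d) + 6"
    by (simp add: algebra_simps power2_eq_square)
  moreover have "107 * (n ^ 2 + m * 2 ^ (d + 2)) = 107 * n ^ 2 + 428 * (m * 2 ^ d)"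
    by (simp add: algebra_simps)
  ultimately have "t \<le> 107 * (n ^ 2 + m * 2 ^ (d + 2))" using *(2) by linarith
  with * show ?thesis by (intro that)
qed

lemma succeeds_program:
  assumes "simple_graph {..<n} E" "1 \<le> m" "greedy E d m n n = (A, M)"
  shows "succeeds program m d n E BR \<longleftrightarrow> (\<exists>e\<in>M. blocked E BR e)"
proof -
  obtain t s where *: "exec (encode n E BR) program (init_state n m d) t s"
    "fst s 0 \<noteq> 0 \<longleftrightarrow> (\<exists>e\<in>M. blocked E BR e)"
    by (rule exec_program[OF assms])
  then show ?thesis
    unfolding succeeds_def using exec_deterministic[OF *(1)] by metis
qed

theorem theorem1p16:
  shows
    "(\<forall>(V :: 'a set) E m d. simple_graph V E \<longrightarrow> 1 \<le> m \<longrightarrow> 1 \<le> d \<longrightarrow>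
        (\<exists>S. independent_edges E S \<and> S \<subseteq> bounded_edges E d \<and> m \<le> card S) \<longrightarrow>
        measure_pmf.prob (random_game V E) {BR. \<not> has_PNE V E BR}
          \<ge> 1 - exp (- (real m * (1 / 8) ^ (2 ^ (2 * d - 2)))))
   \<and> (\<forall>(V :: 'a set) E m d. simple_graph V E \<longrightarrow> 1 \<le> m \<longrightarrow> 1 \<le> d \<longrightarrow>
        m \<le> card (bounded_edges E d) \<longrightarrow>
        measure_pmf.prob (random_game V E) {BR. \<not> has_PNE V E BR}
          \<ge> 1 - exp (- (real m / (2 * real d) * (1 / 8) ^ (2 ^ (2 * d - 2)))))
   \<and> (\<exists>(P :: com) (C :: nat). \<forall>(n :: nat) E m d.
        simple_graph {..<n} E \<longrightarrow> 1 \<le> m \<longrightarrow> 1 \<le> d \<longrightarrow>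
        (\<forall>BR. halts_within P m d n E BR (C * (n ^ 2 + m * 2 ^ (d + 2)))) \<and>
        (\<forall>BR. succeeds P m d n E BR \<longrightarrow> \<not> has_PNE {..<n} E BR) \<and>
        ((\<exists>S. independent_edges E S \<and> S \<subseteq> bounded_edges E d \<and> m \<le> card S) \<longrightarrow>
          measure_pmf.prob (random_game {..<n} E) {BR. succeeds P m d n E BR}
            \<ge> 1 - exp (- (real m * (1 / 8) ^ (2 ^ (2 * d - 2))))) \<and>
        (m \<le> card (bounded_edges E d) \<longrightarrow>
          measure_pmf.prob (random_game {..<n} E) {BR. succeeds P m d n E BR}
            \<ge> 1 - exp (- (real m / (2 * real d) * (1 / 8) ^ (2 ^ (2 * d - 2))))))
   \<and> (\<forall>(V :: 'a set) E S. simple_graph V E \<longrightarrow>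
        max_weight_independent E (edge_weight E) S \<longrightarrow>
        measure_pmf.prob (random_game V E) {BR. \<not> has_PNE V E BR}
          \<ge> 1 - exp (- sum (edge_weight E) S))"
proof (intro conjI allI impI)
  show "measure_pmf.prob (random_game V E) {BR. \<not> has_PNE V E BR}
      \<ge> 1 - exp (- (real m * (1 / 8) ^ (2 ^ (2 * d - 2))))"
    if "simple_graph V E" "1 \<le> d" "\<exists>S. independent_edges E S \<and> S \<subseteq> bounded_edges E d \<and> m \<le> card S"
    for V :: "'a set" and E m d
    using that prob_no_PNE_disjoint_edges[of V E d _ m] by blast
next
  show "measure_pmf.prob (random_game V E) {BR. \<not> has_PNE V E BR}
      \<ge> 1 - exp (- (real m / (2 * real d) * (1 / 8) ^ (2 ^ (2 * d - 2))))"
    if "simple_graph V E" "1 \<le> d" "m \<le> card (bounded_edges E d)" for V :: "'a set" and E m d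
    using that by (rule prob_no_PNE_bounded_edges)
next
  show "\<exists>(P :: com) (C :: nat). \<forall>(n :: nat) E m d.
        simple_graph {..<n} E \<longrightarrow> 1 \<le> m \<longrightarrow> 1 \<le> d \<longrightarrow>
        (\<forall>BR. halts_within P m d n E BR (C * (n ^ 2 + m * 2 ^ (d + 2)))) \<and>
        (\<forall>BR. succeeds P m d n E BR \<longrightarrow> \<not> has_PNE {..<n} E BR) \<and>
        ((\<exists>S. independent_edges E S \<and> S \<subseteq> bounded_edges E d \<and> m \<le> card S) \<longrightarrow>
          measure_pmf.prob (random_game {..<n} E) {BR. succeeds P m d n E BR}
            \<ge> 1 - exp (- (real m * (1 / 8) ^ (2 ^ (2 * d - 2))))) \<and>
        (m \<le> card (bounded_edges E d) \<longrightarrow>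
          measure_pmf.prob (random_game {..<n} E) {BR. succeeds P m d n E BR}
            \<ge> 1 - exp (- (real m / (2 * real d) * (1 / 8) ^ (2 ^ (2 * d - 2)))))"
  proof (intro exI[of _ program] exI[of _ 107] allI impI)
    fix n m d :: nat and E :: "nat set set"
    assume G: "simple_graph {..<n} E" and m: "1 \<le> m" and d: "1 \<le> (d :: nat)"
    obtain A M where greedy: "greedy E d m n n = (A, M)" by fastforce
    note M = greedy_matching[OF G greedy]
    have ME: "M \<subseteq> E" using M(1) by (auto simp: independent_edges_def)
    \<comment> \<open>For the fixed \<open>M\<close>, success is the event that some edge of
      \<open>M\<close> is blocked, so soundness and both success bounds become statements about
      blocked edges.\<close>
    have succ: "succeeds program m d n E BR \<longleftrightarrow> (\<exists>e\<in>M. blocked E BR e)" for BR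
      by (rule succeeds_program[OF G m greedy])
    have "halts_within program m d n E BR (107 * (n ^ 2 + m * 2 ^ (d + 2)))" for BR
      unfolding halts_within_def by (rule exec_program[OF G m greedy, of BR]) blast
    moreover have "\<not> has_PNE {..<n} E BR" if "succeeds program m d n E BR" for BR
      using that ME blocked_no_PNE[OF G] unfolding succ by blast
    ultimately show "(\<forall>BR. halts_within program m d n E BR (107 * (n ^ 2 + m * 2 ^ (d + 2)))) \<and>
        (\<forall>BR. succeeds program m d n E BR \<longrightarrow> \<not> has_PNE {..<n} E BR) \<and>
        ((\<exists>S. independent_edges E S \<and> S \<subseteq> bounded_edges E d \<and> m \<le> card S) \<longrightarrow>
          measure_pmf.prob (random_game {..<n} E) {BR. succeeds program m d n E BR}
            \<ge> 1 - exp (- (real m * (1 / 8) ^ (2 ^ (2 * d - 2))))) \<and>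
        (m \<le> card (bounded_edges E d) \<longrightarrow>
          measure_pmf.prob (random_game {..<n} E) {BR. succeeds program m d n E BR}
            \<ge> 1 - exp (- (real m / (2 * real d) * (1 / 8) ^ (2 ^ (2 * d - 2)))))"
      unfolding succ using prob_blocked_greedy_matching[OF G d M] by blast
  qed
next
  show "measure_pmf.prob (random_game V E) {BR. \<not> has_PNE V E BR}
      \<ge> 1 - exp (- sum (edge_weight E) S)"
    if "simple_graph V E" "max_weight_independent E (edge_weight E) S" for V :: "'a set" and E S
    using that prob_no_PNE_weights by (auto simp: max_weight_independent_def)
qed

end
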